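(* Assume $\alpha > 0$. Let $\mathcal{D}_n=\max\{D[n,j] : -(N-1)\le j\le n\}$ be the maximal degree after $n$ steps of the $N$-interactions model, and let $\mu=\sup\{\gamma_j : j\ge -(N-1)\}$, which is an (almost surely finite) positive random variable. Then $$\mathcal{D}_n \sim \frac{1}{\Gamma(1+\alpha)}\,\frac{\alpha_2}{\alpha}\,\mu\, n^{\alpha}\qquad\text{almost surely as } n\to\infty .$$
   Context: The $N$-interactions model. Fix an integer $N\ge 3$ and parameters $0<p\le 1$, $q,r\in[0,1]$. An $m$-clique is a complete graph on $m$ vertices, $K_m$. At time $n=0$ the graph is a single $K_N$; this graph and all of its cliques (in particular its vertices, its $(N-1)$-cliques and the $N$-clique itself) have initial weight $1$. At each step $n=1,2,\dots$ a set of $N$ vertices interacts: all non-existing edges between them are drawn, so that they form a $K_N$, and the weights of this $K_N$ and of all cliques contained in it are increased by $1$ (a clique that was never contained in the initial or an interacting $K_N$ has weight $0$). The $N$ interacting vertices are chosen, given the past, as follows. - With probability $p$ a new vertex is added, and it interacts with $N-1$ old vertices. With probability $r$ these are the vertices of an $(N-1)$-clique chosen from the existing $(N-1)$-cliques with probability proportional to weight (a clique of weight $w_t$ is chosen with probability $w_t/\sum_h w_h$); with probability $1-r$ they are a uniformly chosen $(N-1)$-element subset of the existing vertices. - With probability $1-p$ no new vertex is added and $N$ old vertices interact. With probability $q$ these are the vertices of an $N$-clique chosen from the existing $N$-cliques with probability proportional to weight; with probability $1-q$ they are a uniformly chosen $N$-element subset of the existing vertices. Constants: $\alpha_1=(1-p)q$,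 $\alpha_2=\frac{N-1}{N}pr$, $\alpha=\alpha_1+\alpha_2$. Labels: the $N$ initial vertices are labelled $0,-1,\dots,-(N-1)$; new vertices are labelled $1,2,\dots$ in the order in which they are added. $W[n,j]$ and $D[n,j]$ are the weight and the degree of the vertex labelled $j$ after the $n$th step, both equal to $0$ if this vertex does not yet exist after $n$ steps. For $\alpha>0$ and each $j\ge-(N-1)$, $\gamma_j$ is the positive random variable $\gamma_j=\Gamma(1+\alpha)\lim_{n\to\infty}n^{-\alpha}W[n,j]$, a limit that exists and is positive almost surely. $\Gamma$ is the Gamma function. The relation $X_n\sim c\,n^{\alpha}$ almost surely means $n^{-\alpha}X_n\to c$ almost surely. *)

theory Defs
  imports "HOL-Probability.Probability"
begin

text \<open>
  A clique is identified with its vertex set; \<open>weight G C\<close> is the weight of the clique on \<open>C\<close>,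
  and the weight of the vertex \<open>j\<close> is the weight of the one-vertex clique \<open>{j}\<close>.
  Edges are two-element sets of vertices.
\<close>

record wgraph =
  verts :: "int set"
  edges :: "int set set"
  weight :: "int set \<Rightarrow> nat"

definition cliques :: "nat \<Rightarrow> wgraph \<Rightarrow> int set set" where
  "cliques m G =
     {C. C \<subseteq> verts G \<and> card C = m \<and> (\<forall>x\<in>C. \<forall>y\<in>C. x \<noteq> y \<longrightarrow> {x, y} \<in> edges G)}"

definition initial_graph :: "nat \<Rightarrow> wgraph" where
  "initial_graph N =
     (let V = {1 - int N..0} in
      \<lparr>verts = V, edges = {e. e \<subseteq> V \<and> card e = 2},
       weight = (\<lambda>C. if C \<noteq> {} \<and> C \<subseteq> V then 1 else 0)\<rparr>)"

definition interact :: "int set \<Rightarrow> wgraph \<Rightarrow> wgraph" where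
  "interact S G =
     \<lparr>verts = verts G \<union> S,
      edges = edges G \<union> {e. e \<subseteq> S \<and> card e = 2},
      weight = (\<lambda>C. weight G C + (if C \<noteq> {} \<and> C \<subseteq> S then 1 else 0))\<rparr>"

text \<open>
  The vertex set at any time is an interval of labels with least element \<open>1 - N\<close>,
  so the next new vertex gets the label following the largest one present.
\<close>

definition new_label :: "wgraph \<Rightarrow> int" where
  "new_label G = Max (verts G) + 1"

definition weighted_clique_pmf :: "nat \<Rightarrow> wgraph \<Rightarrow> int set pmf" where
  "weighted_clique_pmf m G =
     embed_pmf (\<lambda>C. if C \<in> cliques m G
                    then real (weight G C) / (\<Sum>H\<in>cliques m G. real (weight G H)) else 0)"

definition uniform_subset_pmf :: "nat \<Rightarrow> wgraph \<Rightarrow> int set pmf" where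
  "uniform_subset_pmf m G = pmf_of_set {S. S \<subseteq> verts G \<and> card S = m}"

definition interaction_pmf :: "nat \<Rightarrow> real \<Rightarrow> real \<Rightarrow> real \<Rightarrow> wgraph \<Rightarrow> int set pmf" where
  "interaction_pmf N p q r G =
     bind_pmf (bernoulli_pmf p) (\<lambda>add_vertex.
       if add_vertex then
         map_pmf (insert (new_label G))
           (bind_pmf (bernoulli_pmf r) (\<lambda>preferential.
              if preferential then weighted_clique_pmf (N - 1) G
              else uniform_subset_pmf (N - 1) G))
       else
         bind_pmf (bernoulli_pmf q) (\<lambda>preferential.
           if preferential then weighted_clique_pmf N G
           else uniform_subset_pmf N G))"

text \<open>
  The graph after \<open>n\<close> steps, as a function of the sequence \<open>h\<close> of interacting sets, where
  \<open>h k\<close> is the set interacting at step \<open>k \<ge> 1\<close>; the value \<open>h 0\<close> is never used.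
\<close>

primrec graph_after :: "nat \<Rightarrow> (nat \<Rightarrow> int set) \<Rightarrow> nat \<Rightarrow> wgraph" where
  "graph_after N h 0 = initial_graph N"
| "graph_after N h (Suc n) = interact (h (Suc n)) (graph_after N h n)"

text \<open>
  An arbitrary probability space carrying random interacting sets \<open>I 1, I 2, \<dots>\<close> with the
  prescribed conditional laws. The past is the sequence of sets that have interacted so far,
  which determines the graph and all weights; since it takes only countably many values,
  elementary conditional probabilities suffice.
\<close>

locale N_interactions_model = prob_space M
  for M :: "'a measure" and N :: nat and p q r :: real and I :: "nat \<Rightarrow> 'a \<Rightarrow> int set" +
  assumes interacting_set_measurable:
      "\<And>n. n \<ge> 1 \<Longrightarrow> I n \<in> measurable M (count_space {S. finite S})"
    and interacting_set_law:
      "\<And>n h S. \<P>(\<omega> in M. \<forall>k\<in>{1..n}. I k \<omega> = h k) > 0 \<Longrightarrow>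
         \<P>(\<omega> in M. I (Suc n) \<omega> = S \<bar> \<forall>k\<in>{1..n}. I k \<omega> = h k)
           = pmf (interaction_pmf N p q r (graph_after N h n)) S"

definition vertex_weight :: "nat \<Rightarrow> (nat \<Rightarrow> int set) \<Rightarrow> nat \<Rightarrow> int \<Rightarrow> nat" where
  "vertex_weight N h n j = weight (graph_after N h n) {j}"

definition vertex_degree :: "nat \<Rightarrow> (nat \<Rightarrow> int set) \<Rightarrow> nat \<Rightarrow> int \<Rightarrow> nat" where
  "vertex_degree N h n j = card {i. {i, j} \<in> edges (graph_after N h n)}"

definition max_degree :: "nat \<Rightarrow> (nat \<Rightarrow> int set) \<Rightarrow> nat \<Rightarrow> nat" where
  "max_degree N h n = Max (vertex_degree N h n ` {1 - int N..int n})"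

definition alpha1 :: "real \<Rightarrow> real \<Rightarrow> real" where
  "alpha1 p q = (1 - p) * q"

definition alpha2 :: "nat \<Rightarrow> real \<Rightarrow> real \<Rightarrow> real" where
  "alpha2 N p r = (real N - 1) / real N * p * r"

definition alpha :: "nat \<Rightarrow> real \<Rightarrow> real \<Rightarrow> real \<Rightarrow> real" where
  "alpha N p q r = alpha1 p q + alpha2 N p r"

definition gamma_limit :: "nat \<Rightarrow> real \<Rightarrow> (nat \<Rightarrow> int set) \<Rightarrow> int \<Rightarrow> real" where
  "gamma_limit N a h j =
     Gamma (1 + a) * lim (\<lambda>n. real n powr (- a) * real (vertex_weight N h n j))"

text \<open>The supremum is taken in the extended reals, so that its finiteness is a genuine claim.\<close>

definition mu_sup :: "nat \<Rightarrow> real \<Rightarrow> (nat \<Rightarrow> int set) \<Rightarrow> ereal" where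
  "mu_sup N a h = (SUP j\<in>{1 - int N..}. ereal (gamma_limit N a h j))"

end

theory Submission
  imports Defs "HOL-Real_Asymp.Real_Asymp"
begin

text \<open>
  Let \<open>V\<close> be the number of vertices after \<open>n\<close> steps and let \<open>W\<close>, \<open>D\<close> be the weight and the degree of a
  vertex. It takes part in the next step with conditional probability \<open>\<alpha> W / (n + 1) + O(1 / V)\<close>, and
  its degree grows in conditional mean by \<open>\<alpha>\<^sub>2 W / (n + 1) + O(1 / V)\<close>, where \<open>V\<close> grows linearly. Let
  \<open>a\<^sub>n = (1 + \<alpha>/1) \<dots> (1 + \<alpha>/n)\<close>, which is asymptotic to \<open>n\<^sup>\<alpha> / \<Gamma>(1 + \<alpha>)\<close>.
  The increments of \<open>W / a\<^sub>n\<close> have summable conditional means and second moments, so \<open>W / a\<^sub>n\<close>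
  converges; the same bounds and Kronecker's lemma give \<open>(D - (\<alpha>\<^sub>2/\<alpha>) W) / a\<^sub>n \<longrightarrow> 0\<close>.

  To exchange the limit with the maximum one needs control that is uniform over late vertices. For
  \<open>m \<alpha> \<ge> 2\<close> the sum over the vertices born after time \<open>J\<close> of a rising factorial of length \<open>m\<close> of \<open>W\<close>,
  divided by the product for \<open>m \<alpha>\<close>, is a nonnegative supermartingale up to a drift from new vertices
  that is summable, with sum tending to 0 as \<open>J\<close> grows. The maximal inequality then bounds
  \<open>W / a\<^sub>n\<close> uniformly for late vertices. Positivity of the supremum comes from one initial vertex: a
  function of order \<open>1 / sqrt W\<close>, suitably normalised, is a nonnegative supermartingale, hence bounded.
\<close>

section \<open>Products of Gamma type and limits of maxima\<close>

text \<open>The obstacle is the uniform choices: they hit a given vertex with probability of order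
  1/V, where V is random and only eventually, almost surely, of order n. Most estimates are
  therefore made on histories that satisfy a density condition, and the process is truncated where
  it fails. The random times and bounds used for truncation range over the natural numbers, so that
  countably many null sets suffice. Moments of order m serve for late vertices because each step may
  bring a new vertex of weight 1: the births contribute a series with terms of order n^(-m alpha),
  and alpha is at most 1. The bound 2 for m alpha makes this series comparable with the inverse
  squares. The ratio alpha_2/alpha is the share of a vertex's preferential interactions that bring
  it a new neighbour: choosing an existing N-clique draws no edge, and choosing an existing
  (N-1)-clique gives each of its members exactly the edge to the new vertex. The inverse square root
  yields positivity because it decreases in W: the uniform choices can then only lower it.\<close>

definition rise :: "real \<Rightarrow> nat \<Rightarrow> real" where
  "rise z n = (\<Prod>k<n. 1 + z / real (Suc k))"

lemma rise_0 [simp]: "rise z 0 = 1"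
  by (simp add: rise_def)

lemma rise_Suc: "rise z (Suc n) = rise z n * (1 + z / real (Suc n))"
  by (simp add: rise_def)

text \<open>The range of \<open>z\<close> admits the negative parameters \<open>- 1 / 2\<close> and
  \<open>- \<alpha> / 2\<close> of the positivity argument.\<close>

lemma rise_pos: "z > -1 \<Longrightarrow> rise z n > 0"
  unfolding rise_def
proof (rule prod_pos)
  fix k assume "z > -1"
  have "- 1 < z / real (Suc k)"
  proof -
    have "- real (Suc k) < z" using \<open>z > -1\<close> by simp
    then show ?thesis by (simp add: field_simps)
  qed
  then show "0 < 1 + z / real (Suc k)" by simp
qed

lemma rise_mono: "0 \<le> y \<Longrightarrow> y \<le> z \<Longrightarrow> rise y n \<le> rise z n"
  unfolding rise_def by (intro prod_mono) (auto simp: divide_right_mono)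

lemma rise_ge_1: "0 \<le> z \<Longrightarrow> rise z n \<ge> 1"
  unfolding rise_def by (intro prod_ge_1) auto

lemma incseq_rise: "0 \<le> z \<Longrightarrow> incseq (rise z)"
  using rise_ge_1[of z] by (intro incseq_SucI) (simp add: rise_Suc mult_left_mono order.trans[of 0 1] algebra_simps)

lemma rise_pochhammer: "rise z n = pochhammer (1 + z) n / fact n"
proof (induction n)
  case (Suc n)
  have "1 + z / real (Suc n) = (1 + z + real n) / real (Suc n)"
    by (simp add: field_simps)
  then show ?case
    using Suc by (simp add: rise_Suc pochhammer_Suc)
qed simp

text \<open>\<open>Gamma_series (1 + z)\<close> contains one pochhammer factor more,
  \<open>1 + z + n\<close>, and one power of n more than the product here; the quotient of these two
  extras tends to 1.\<close>

lemma rise_asymp: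
  assumes "z > -1"
  shows "(\<lambda>n. real n powr (- z) * rise z n) \<longlonglongrightarrow> 1 / Gamma (1 + z)"
proof -
  have nonpos: "1 + z \<notin> \<int>\<^sub>\<le>\<^sub>0" using assms by (auto simp: nonpos_Ints_def)
  have "(\<lambda>n. (real n / (1 + z + real n)) / Gamma_series (1 + z) n) \<longlonglongrightarrow> 1 / Gamma (1 + z)"
  proof (rule tendsto_divide)
    show "(\<lambda>n. real n / (1 + z + real n)) \<longlonglongrightarrow> 1" by real_asymp
    show "Gamma_series (1 + z) \<longlonglongrightarrow> Gamma (1 + z)" by (rule Gamma_series_LIMSEQ)
    show "Gamma (1 + z) \<noteq> 0" using nonpos by (simp add: Gamma_eq_zero_iff)
  qed
  moreover have "\<forall>\<^sub>F n in sequentially.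
      (real n / (1 + z + real n)) / Gamma_series (1 + z) n = real n powr (- z) * rise z n"
    using eventually_gt_at_top[of 0]
  proof eventually_elim
    case (elim n)
    have "pochhammer (1 + z) n > 0" using assms by (intro pochhammer_pos) simp
    moreover have "exp ((1 + z) * ln (real n)) = real n * real n powr z"
      using elim by (simp add: powr_def distrib_right exp_add)
    moreover have "1 + z + real n > 0" using assms by simp
    ultimately show ?case using elim
      unfolding Gamma_series_def rise_pochhammer
      by (simp add: pochhammer_Suc powr_minus divide_simps)
  qed
  ultimately show ?thesis by (rule Lim_transform_eventually)
qed

lemma rise_le_powr:
  assumes "z > -1"
  obtains c where "c > 0" "\<And>n. n \<ge> 1 \<Longrightarrow> rise z n \<le> c * real n powr z"
proof -
  have "Bseq (\<lambda>n. real n powr (- z) * rise z n)"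
    using rise_asymp[OF assms] by (intro convergent_imp_Bseq convergentI)
  then obtain c where c: "c > 0" "\<And>n. norm (real n powr (- z) * rise z n) \<le> c"
    by (auto simp: Bseq_def)
  have "rise z n \<le> c * real n powr z" if "n \<ge> 1" for n
  proof -
    have "real n powr (- z) * rise z n \<le> c" using c(2)[of n] by simp
    then show ?thesis using that by (simp add: powr_minus field_simps)
  qed
  with c(1) show thesis by (rule that)
qed

lemma filterlim_rise:
  assumes "z > 0"
  shows "filterlim (rise z) at_top sequentially"
proof -
  have "filterlim (\<lambda>n. (real n powr (- z) * rise z n) * real n powr z) at_top sequentially"
    using assms
    by (intro filterlim_tendsto_pos_mult_at_top[OF rise_asymp]) (auto, real_asymp)
  moreover have "\<forall>\<^sub>F n in sequentially. (real n powr (- z) * rise z n) * real n powr z = rise z n"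
    using eventually_gt_at_top[of 0] by eventually_elim (simp add: powr_minus field_simps)
  ultimately show ?thesis by (subst (asm) filterlim_cong[OF refl refl]) auto
qed

lemma rise_2: "rise 2 n = real (n + 1) * real (n + 2) / 2"
  by (induction n) (simp_all add: rise_Suc field_simps)

text \<open>By monotonicity in \<open>z\<close> it is enough to compare with \<open>z = 2\<close>,
  where the product is the quadratic polynomial of \<open>rise_2\<close>.\<close>

lemma summable_inverse_rise:
  assumes "z \<ge> 2"
  shows "summable (\<lambda>n. 1 / rise z (Suc n))"
proof (rule summable_comparison_test')
  show "summable (\<lambda>n. 2 * (1 / real (Suc n) ^ 2))"
    by (rule summable_mult) (use inverse_power_summable[of 2, where 'a=real] in
       \<open>subst summable_Suc_iff, simp add: inverse_eq_divide\<close>)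
  fix n
  have "real (Suc n) ^ 2 / 2 \<le> rise 2 (Suc n)"
    unfolding rise_2 by (simp add: power2_eq_square) (intro mult_mono, auto)
  also have "\<dots> \<le> rise z (Suc n)" using assms by (intro rise_mono) auto
  finally have "1 / rise z (Suc n) \<le> 1 / (real (Suc n) ^ 2 / 2)"
    by (intro divide_left_mono mult_pos_pos) (use rise_pos[of z "Suc n"] assms in auto)
  then show "norm (1 / rise z (Suc n)) \<le> 2 * (1 / real (Suc n) ^ 2)"
    using rise_pos[of z "Suc n"] assms by simp
qed

text \<open>The terms telescope: they are the decrements of \<open>1 / rise z n\<close>, divided by
  \<open>z\<close>. This series dominates the conditional means and second moments of a single
  vertex once its weight is known to be O(\<open>rise \<alpha> n\<close>).\<close>

lemma summable_inverse_mult_rise: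
  assumes "z > 0"
  shows "summable (\<lambda>n. 1 / (real (Suc n) * rise z (Suc n)))"
proof -
  have pos: "rise z n > 0" for n using assms by (intro rise_pos) auto
  have "(\<lambda>n. 1 / rise z n) \<longlonglongrightarrow> 0"
    by (rule tendsto_divide_0[OF tendsto_const filterlim_at_top_imp_at_infinity[OF filterlim_rise[OF assms]]])
  then have "summable (\<lambda>n. 1 / rise z n - 1 / rise z (Suc n))"
    by (rule telescope_summable')
  then have "summable (\<lambda>n. (1 / rise z n - 1 / rise z (Suc n)) / z)"
    by (rule summable_divide)
  moreover have "(1 / rise z n - 1 / rise z (Suc n)) / z = 1 / (real (Suc n) * rise z (Suc n))" for n
  proof -
    have "1 + z / real (Suc n) > 0" using assms by (intro add_pos_pos divide_pos_pos) auto
    then have "1 / rise z n = (1 + z / real (Suc n)) / rise z (Suc n)"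
      using pos[of n] by (simp add: rise_Suc del: of_nat_Suc)
    then have "(1 / rise z n - 1 / rise z (Suc n)) / z = (z / real (Suc n)) / rise z (Suc n) / z"
      by (simp add: diff_divide_distrib[symmetric] del: of_nat_Suc)
    then show ?thesis using assms by simp
  qed
  ultimately show ?thesis by simp
qed

text \<open>Summation by parts, with \<open>r\<close> the negative of the remainder of the
  convergent series.\<close>

lemma kronecker:
  fixes x b :: "nat \<Rightarrow> real"
  assumes "summable (\<lambda>k. x k / b k)" and pos: "\<And>k. b k > 0" and inc: "incseq b"
    and "filterlim b at_top sequentially"
  shows "(\<lambda>n. (\<Sum>k<n. x k) / b n) \<longlonglongrightarrow> 0"
proof -
  define r where "r n = (\<Sum>k<n. x k / b k) - (\<Sum>k. x k / b k)" for n
  have r0: "r \<longlonglongrightarrow> 0"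
    unfolding r_def using summable_LIMSEQ[OF assms(1)] by (simp add: LIM_zero)
  have x: "x n = b n * (r (Suc n) - r n)" for n
    using pos[of n] by (simp add: r_def)
  show ?thesis
  proof (rule LIMSEQ_I)
    fix e :: real assume "e > 0"
    \<comment> \<open>Three terms, each at most \<open>d * b n\<close>, have to add up to less than
      \<open>e * b n\<close>.\<close>
    define d where "d = e / 4"
    have "d > 0" using \<open>e > 0\<close> by (simp add: d_def)
    from LIMSEQ_D[OF r0 this] obtain m where m: "\<And>n. n \<ge> m \<Longrightarrow> \<bar>r n\<bar> \<le> d"
      by (metis diff_zero less_eq_real_def real_norm_def)
    define C where "C = \<bar>(\<Sum>k<m. x k) - b m * r m\<bar>"
    \<comment> \<open>Each step changes the difference by
      \<open>(b (Suc n) - b n) * r (Suc n)\<close>, and these changes add up to at most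
      \<open>d\<close> times the total increase of \<open>b\<close>.\<close>
    have main: "\<bar>(\<Sum>k<n. x k) - b n * r n\<bar> \<le> C + d * (b n - b m)" if "n \<ge> m" for n
      using that
    proof (induction n rule: dec_induct)
      case base then show ?case by (simp add: C_def)
    next
      case (step n)
      have "\<bar>(b (Suc n) - b n) * r (Suc n)\<bar> \<le> (b (Suc n) - b n) * d"
        unfolding abs_mult using m[of "Suc n"] step incseq_SucD[OF inc, of n]
        by (intro mult_mono) auto
      moreover have "(\<Sum>k<Suc n. x k) - b (Suc n) * r (Suc n)
          = ((\<Sum>k<n. x k) - b n * r n) - (b (Suc n) - b n) * r (Suc n)"
        by (simp add: x[of n] algebra_simps)
      ultimately show ?case using step.IH by (simp add: algebra_simps)
    qed
    from assms(4) have "eventually (\<lambda>n. b n \<ge> C / d + 1) sequentially"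
      by (simp add: filterlim_at_top)
    then obtain n1 where n1: "\<And>n. n \<ge> n1 \<Longrightarrow> b n \<ge> C / d + 1" by (auto simp: eventually_sequentially)
    have "norm ((\<Sum>k<n. x k) / b n - 0) < e" if n: "n \<ge> max m n1" for n
    proof -
      have "C \<le> d * b n" using n1[of n] n \<open>d > 0\<close> by (simp add: field_simps)
      moreover have "\<bar>b n * r n\<bar> \<le> b n * d"
        unfolding abs_mult using m[of n] n pos[of n] by (intro mult_mono) auto
      moreover have "d * b m > 0" using \<open>d > 0\<close> pos[of m] by simp
      ultimately have "\<bar>\<Sum>k<n. x k\<bar> < 4 * d * b n"
        using main[of n] n mult_pos_pos[OF \<open>d > 0\<close> pos[of n]] by (simp add: algebra_simps)
      then show ?thesis using pos[of n] by (simp add: d_def field_simps)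
    qed
    then show "\<exists>no. \<forall>n\<ge>no. norm ((\<Sum>k<n. x k) / b n - 0) < e" by blast
  qed
qed

text \<open>From below one label is enough. From above, finitely many labels are controlled by
  pointwise convergence and all others by the uniform bound \<open>tail\<close>; pointwise
  convergence alone would let mass escape to labels that grow with \<open>n\<close>.\<close>

lemma Max_tendsto_SUP:
  fixes x :: "nat \<Rightarrow> int \<Rightarrow> real" and l :: "int \<Rightarrow> real"
  assumes lim: "\<And>j. j \<ge> j0 \<Longrightarrow> (\<lambda>n. x n j) \<longlonglongrightarrow> l j"
    and nonneg: "\<And>n j. x n j \<ge> 0"
    and tail: "\<And>\<epsilon>. \<epsilon> > 0 \<Longrightarrow> \<exists>J. \<forall>\<^sub>F n in sequentially. \<forall>j\<ge>J. x n j \<le> \<epsilon>"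
  shows "bdd_above (l ` {j0..})"
    and "(\<lambda>n. Max (x n ` {j0..int n})) \<longlonglongrightarrow> (SUP j\<in>{j0..}. l j)"
proof -
  have l0: "l j \<ge> 0" if "j \<ge> j0" for j
    using LIMSEQ_le_const[OF lim[OF that], of 0] nonneg by auto
  show bdd: "bdd_above (l ` {j0..})"
  proof -
    obtain J where J: "\<forall>\<^sub>F n in sequentially. \<forall>j\<ge>J. x n j \<le> 1" using tail[of 1] by auto
    have "l j \<le> 1" if "j \<ge> J" "j \<ge> j0" for j
    proof (rule tendsto_upperbound[OF lim[OF that(2)]])
      show "\<forall>\<^sub>F n in sequentially. x n j \<le> 1" using J by eventually_elim (use that in auto)
    qed simp
    then have "l j \<in> {..1} \<union> l ` {j0..J}" if "j \<ge> j0" for j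
      using that by (cases "j \<ge> J") auto
    then have "l ` {j0..} \<subseteq> {..1} \<union> l ` {j0..J}"
      by blast
    moreover have "bdd_above ({..1} \<union> l ` {j0..J})"
      by (simp add: bdd_above_Un)
    ultimately show ?thesis by (rule bdd_above_mono[rotated])
  qed
  define s where "s = (SUP j\<in>{j0..}. l j)"
  have le_s: "l j \<le> s" if "j \<ge> j0" for j
    unfolding s_def using that by (intro cSUP_upper bdd) auto
  \<comment> \<open>Since \<open>s\<close> is nonnegative, a late label bounded by the small
    constant stays below \<open>s\<close> plus that constant.\<close>
  have s0: "s \<ge> 0" using le_s[of j0] l0[of j0] by simp
  show "(\<lambda>n. Max (x n ` {j0..int n})) \<longlonglongrightarrow> (SUP j\<in>{j0..}. l j)"
    unfolding s_def[symmetric]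
  proof (rule order_tendstoI)
    fix a assume "a < s"
    then obtain j where j: "j \<ge> j0" "l j > a"
      unfolding s_def using bdd by (subst (asm) less_cSUP_iff) auto
    have "\<forall>\<^sub>F n in sequentially. x n j > a" using lim[OF j(1)] j(2) by (rule order_tendstoD)
    moreover have "\<forall>\<^sub>F n in sequentially. n \<ge> nat j" by (rule eventually_ge_at_top)
    ultimately show "\<forall>\<^sub>F n in sequentially. Max (x n ` {j0..int n}) > a"
    proof eventually_elim
      case (elim n)
      then have "x n j \<in> x n ` {j0..int n}" using j by auto
      then show ?case using elim by (meson Max_ge finite_atLeastAtMost_int finite_imageI less_le_trans)
    qed
  next
    fix a assume "a > s"
    define \<epsilon> where "\<epsilon> = (a - s) / 2"
    have \<epsilon>: "\<epsilon> > 0" "s + \<epsilon> < a" using \<open>a > s\<close> by (auto simp: \<epsilon>_def field_simps)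
    obtain J where J: "\<forall>\<^sub>F n in sequentially. \<forall>j\<ge>J. x n j \<le> \<epsilon>" using tail[OF \<epsilon>(1)] by auto
    have "\<forall>\<^sub>F n in sequentially. \<forall>j\<in>{j0..J}. x n j < s + \<epsilon>"
    proof (subst eventually_ball_finite_distrib)
      show "\<forall>j\<in>{j0..J}. \<forall>\<^sub>F n in sequentially. x n j < s + \<epsilon>"
      proof
        fix j assume "j \<in> {j0..J}"
        then show "\<forall>\<^sub>F n in sequentially. x n j < s + \<epsilon>"
          using le_s[of j] \<epsilon> by (intro order_tendstoD(2)[OF lim]) auto
      qed
    qed simp
    then show "\<forall>\<^sub>F n in sequentially. Max (x n ` {j0..int n}) < a"
      using J eventually_ge_at_top[of "nat j0"]
    proof eventually_elim
      case (elim n)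
      have "x n j < a" if "j \<ge> j0" for j
      proof (cases "j \<le> J")
        case True
        then have "x n j < s + \<epsilon>" using elim that by auto
        then show ?thesis using \<epsilon> by linarith
      next
        case False
        then have "x n j \<le> \<epsilon>" using elim by auto
        then show ?thesis using \<epsilon> s0 by linarith
      qed
      moreover have "j0 \<le> int n" using elim by linarith
      ultimately show ?case by (subst Max_less_iff) auto
    qed
  qed
qed

section \<open>One step of the graph dynamics\<close>

text \<open>\<open>vertex_degree\<close> refers to a whole sequence of interacting sets; one-step
  estimates need the degree in a given graph.\<close>

definition degree_in :: "wgraph \<Rightarrow> int \<Rightarrow> nat" where
  "degree_in G j = card {i. {i, j} \<in> edges G}"

lemma interact_simps [simp]:
  "verts (interact S G) = verts G \<union> S"
  "edges (interact S G) = edges G \<union> {e. e \<subseteq> S \<and> card e = 2}"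
  "weight (interact S G) C = weight G C + (if C \<noteq> {} \<and> C \<subseteq> S then 1 else 0)"
  by (simp_all add: interact_def)

lemma card_subsets_containing:
  assumes "finite S" "j \<in> S" "m \<ge> 1"
  shows "card {C. C \<subseteq> S \<and> card C = m \<and> j \<in> C} = (card S - 1) choose (m - 1)"
proof -
  have "bij_betw (insert j) {C. C \<subseteq> S - {j} \<and> card C = m - 1} {C. C \<subseteq> S \<and> card C = m \<and> j \<in> C}"
  proof (rule bij_betw_byWitness[where f' = "\<lambda>C. C - {j}"])
    show "insert j ` {C. C \<subseteq> S - {j} \<and> card C = m - 1} \<subseteq> {C. C \<subseteq> S \<and> card C = m \<and> j \<in> C}"
    proof safe
      fix C assume C: "C \<subseteq> S - {j}" "card C = m - 1"
      then have "finite C" using assms finite_subset by blast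
      then show "card (insert j C) = m" using C assms by (subst card_insert_disjoint) auto
    qed (use assms in auto)
    show "(\<lambda>C. C - {j}) ` {C. C \<subseteq> S \<and> card C = m \<and> j \<in> C} \<subseteq> {C. C \<subseteq> S - {j} \<and> card C = m - 1}"
      using assms by (auto simp: card_Diff_singleton)
  qed auto
  then have "card {C. C \<subseteq> S \<and> card C = m \<and> j \<in> C} = card {C. C \<subseteq> S - {j} \<and> card C = m - 1}"
    by (simp add: bij_betw_same_card)
  also have "\<dots> = (card S - 1) choose (m - 1)"
    using assms by (subst n_subsets) (auto simp: card_Diff_singleton)
  finally show ?thesis .
qed

text \<open>The invariant of the graph after n steps. The two clique sums are its core: the initial
  graph and each interaction add 1 to all m-subsets of one N-set, whence n + 1 times a binomial
  coefficient in total, and N - 1 choose m - 1 for each interaction that involves j. Their quotient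
  makes the law of a preferential choice explicit. Labels form an interval, so the number of
  vertices determines the next label.\<close>

definition model_graph :: "nat \<Rightarrow> nat \<Rightarrow> wgraph \<Rightarrow> bool" where
  "model_graph N n G \<longleftrightarrow>
     (\<exists>V\<ge>N. verts G = {1 - int N..int V - int N} \<and> V \<le> N + n) \<and>
     (\<forall>C. weight G C > 0 \<longrightarrow> C \<noteq> {} \<and> C \<subseteq> verts G \<and>
        (\<forall>x\<in>C. \<forall>y\<in>C. x \<noteq> y \<longrightarrow> {x, y} \<in> edges G)) \<and>
     (\<forall>e\<in>edges G. e \<subseteq> verts G \<and> card e = 2) \<and>
     (\<forall>m\<ge>1. (\<Sum>C\<in>cliques m G. weight G C) = Suc n * (N choose m)) \<and>
     (\<forall>m\<ge>1. \<forall>j. (\<Sum>C\<in>cliques m G. weight G C * of_bool (j \<in> C))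
         = (N - 1 choose (m - 1)) * weight G {j}) \<and>
     (\<forall>j\<in>verts G. weight G {j} \<ge> 1) \<and>
     (\<forall>j. weight G {j} \<le> Suc n) \<and>
     (\<forall>j. degree_in G j \<le> (N - 1) * weight G {j})"

text \<open>A superset of the support of the law of the next interacting set.\<close>

definition admissible :: "nat \<Rightarrow> wgraph \<Rightarrow> int set \<Rightarrow> bool" where
  "admissible N G S \<longleftrightarrow> finite S \<and> card S = N \<and>
     (S \<subseteq> verts G \<or> (\<exists>C\<subseteq>verts G. S = insert (new_label G) C))"

lemma sum_subsets_of_bool:
  assumes "finite S" "m \<ge> 1"
  shows "(\<Sum>C | C \<subseteq> S \<and> card C = m. of_bool (j \<in> C) :: nat)
    = (if j \<in> S then card S - 1 choose (m - 1) else 0)"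
proof -
  have "(\<Sum>C | C \<subseteq> S \<and> card C = m. of_bool (j \<in> C) :: nat)
      = card ({C. C \<subseteq> S \<and> card C = m} \<inter> {C. j \<in> C})"
    using assms by (subst sum_of_bool_eq) auto
  also have "{C. C \<subseteq> S \<and> card C = m} \<inter> {C. j \<in> C} = {C. C \<subseteq> S \<and> card C = m \<and> j \<in> C}"
    by auto
  finally have *: "(\<Sum>C | C \<subseteq> S \<and> card C = m. of_bool (j \<in> C) :: nat)
      = card {C. C \<subseteq> S \<and> card C = m \<and> j \<in> C}" .
  show ?thesis
  proof (cases "j \<in> S")
    case True
    then show ?thesis using assms by (simp only: * card_subsets_containing if_True)
  next
    case False
    then have "{C. C \<subseteq> S \<and> card C = m \<and> j \<in> C} = {}" by auto
    then show ?thesis using False * by simp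
  qed
qed

lemma degree_in_mono_bound:
  assumes "finite S" "card S = N" "finite {i. {i, j} \<in> edges G}" "N \<ge> 1"
  shows "degree_in G j \<le> degree_in (interact S G) j"
    and "degree_in (interact S G) j \<le> degree_in G j + (N - 1) * of_bool (j \<in> S)"
proof -
  let ?A = "{i. {i, j} \<in> edges G}" and ?B = "if j \<in> S then S - {j} else {}"
  have sub: "{i. {i, j} \<in> edges (interact S G)} \<subseteq> ?A \<union> ?B"
    by (auto simp: card_2_iff)
  have finB: "finite (?A \<union> ?B)" using assms by auto
  show "degree_in G j \<le> degree_in (interact S G) j"
    unfolding degree_in_def using finite_subset[OF sub finB] by (intro card_mono) auto
  have "degree_in (interact S G) j \<le> card (?A \<union> ?B)"
    unfolding degree_in_def by (rule card_mono[OF finB sub])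
  also have "\<dots> \<le> card ?A + card ?B" by (rule card_Un_le)
  also have "card ?B = (N - 1) * of_bool (j \<in> S)" using assms by simp
  finally show "degree_in (interact S G) j \<le> degree_in G j + (N - 1) * of_bool (j \<in> S)"
    by (simp add: degree_in_def)
qed

section \<open>The graph invariant and its preservation by an interaction\<close>

context
  fixes N n :: nat and G :: wgraph
  assumes N: "N \<ge> 3" and G: "model_graph N n G"
begin

lemma verts_eq: "verts G = {1 - int N..int (card (verts G)) - int N}"
  and card_verts_ge: "card (verts G) \<ge> N"
  and card_verts_le: "card (verts G) \<le> N + n"
proof -
  from G obtain V where V: "V \<ge> N" "verts G = {1 - int N..int V - int N}" "V \<le> N + n"
    unfolding model_graph_def by blast
  then have "card (verts G) = V" by simp
  with V show "verts G = {1 - int N..int (card (verts G)) - int N}"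
    "card (verts G) \<ge> N" "card (verts G) \<le> N + n" by simp_all
qed

lemma finite_verts: "finite (verts G)"
  by (subst verts_eq) simp

lemma new_label_eq: "new_label G = int (card (verts G)) - int N + 1"
proof -
  have "Max (verts G) = int (card (verts G)) - int N"
    using card_verts_ge N by (subst verts_eq, intro Max_eqI) auto
  then show ?thesis by (simp add: new_label_def)
qed

lemma new_label_notin: "new_label G \<notin> verts G"
  unfolding new_label_eq by (subst verts_eq) simp

lemma weight_posD:
  "weight G C > 0 \<Longrightarrow> C \<noteq> {} \<and> C \<subseteq> verts G \<and> (\<forall>x\<in>C. \<forall>y\<in>C. x \<noteq> y \<longrightarrow> {x, y} \<in> edges G)"
  using G unfolding model_graph_def by blast

lemma edgesD: "e \<in> edges G \<Longrightarrow> e \<subseteq> verts G \<and> card e = 2"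
  using G unfolding model_graph_def by blast

lemma total_weight: "m \<ge> 1 \<Longrightarrow> (\<Sum>C\<in>cliques m G. weight G C) = Suc n * (N choose m)"
  using G unfolding model_graph_def by blast

lemma total_weight_containing:
  "m \<ge> 1 \<Longrightarrow> (\<Sum>C\<in>cliques m G. weight G C * of_bool (j \<in> C)) = (N - 1 choose (m - 1)) * weight G {j}"
  using G unfolding model_graph_def by blast

lemma weight_vertex_pos: "j \<in> verts G \<Longrightarrow> weight G {j} \<ge> 1"
  using G unfolding model_graph_def by blast

lemma weight_vertex_le: "weight G {j} \<le> Suc n"
  using G unfolding model_graph_def by blast

lemma degree_le_weight: "degree_in G j \<le> (N - 1) * weight G {j}"
  using G unfolding model_graph_def by blast

lemma weight_notin_verts: "j \<notin> verts G \<Longrightarrow> weight G {j} = 0"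
  using weight_posD[of "{j}"] by auto

lemma finite_cliques: "finite (cliques m G)"
  unfolding cliques_def using finite_verts by (intro finite_subset[OF _ finite_Pow_iff[THEN iffD2]]) auto

lemma finite_nbrs: "finite {i. {i, j} \<in> edges G}"
  by (rule finite_subset[OF _ finite_verts]) (use edgesD in blast)

text \<open>The new edges can complete cliques that are neither cliques of \<open>G\<close> nor
  subsets of \<open>S\<close>; such cliques had weight 0 and gain none. The function
  \<open>f\<close> is left open to cover both clique sums of the invariant, the total one and the
  one over cliques containing a vertex.\<close>

lemma sum_cliques_interact:
  assumes "finite S" "m \<ge> 1"
  shows "(\<Sum>C\<in>cliques m (interact S G). weight (interact S G) C * (f C :: nat))
    = (\<Sum>C\<in>cliques m G. weight G C * f C) + (\<Sum>C | C \<subseteq> S \<and> card C = m. f C)"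
proof -
  let ?G = "interact S G"
  have fin: "finite (cliques m ?G)"
    by (rule finite_subset[of _ "Pow (verts G \<union> S)"]) (use finite_verts assms in \<open>auto simp: cliques_def\<close>)
  have "(\<Sum>C\<in>cliques m ?G. weight ?G C * f C)
     = (\<Sum>C\<in>cliques m ?G. weight G C * f C) + (\<Sum>C\<in>cliques m ?G. if C \<noteq> {} \<and> C \<subseteq> S then f C else 0)"
    unfolding sum.distrib[symmetric] by (intro sum.cong) (auto simp: algebra_simps)
  also have "(\<Sum>C\<in>cliques m ?G. weight G C * f C) = (\<Sum>C\<in>cliques m G. weight G C * f C)"
  proof (rule sum.mono_neutral_right[OF fin])
    show "cliques m G \<subseteq> cliques m ?G" by (auto simp: cliques_def)
    show "\<forall>C\<in>cliques m ?G - cliques m G. weight G C * f C = 0"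
    proof
      fix C assume "C \<in> cliques m ?G - cliques m G"
      then have "\<not> weight G C > 0" using weight_posD[of C] by (auto simp: cliques_def)
      then show "weight G C * f C = 0" by simp
    qed
  qed
  also have "(\<Sum>C\<in>cliques m ?G. if C \<noteq> {} \<and> C \<subseteq> S then f C else 0)
     = (\<Sum>C\<in>cliques m ?G \<inter> {C. C \<noteq> {} \<and> C \<subseteq> S}. f C)"
    using fin by (simp add: sum.inter_restrict)
  also have "cliques m ?G \<inter> {C. C \<noteq> {} \<and> C \<subseteq> S} = {C. C \<subseteq> S \<and> card C = m}"
    using assms(2) by (auto simp: cliques_def card_2_iff)
  finally show ?thesis .
qed

lemma model_graph_interact:
  assumes S: "admissible N G S"
  shows "model_graph N (Suc n) (interact S G)"
  unfolding model_graph_def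
proof (intro conjI allI ballI impI)
  let ?G = "interact S G"
  have fin: "finite S" "card S = N" using S by (auto simp: admissible_def)
  consider "S \<subseteq> verts G" | C where "C \<subseteq> verts G" "S = insert (new_label G) C"
    using S unfolding admissible_def by auto
  then show "\<exists>V\<ge>N. verts ?G = {1 - int N..int V - int N} \<and> V \<le> N + Suc n"
  proof cases
    case 1
    then show ?thesis
      using verts_eq card_verts_ge card_verts_le
      by (intro exI[of _ "card (verts G)"]) (auto simp: Un_absorb2)
  next
    case 2
    have "verts G \<union> S = insert (new_label G) (verts G)" using 2 by auto
    also have "\<dots> = {1 - int N..int (Suc (card (verts G))) - int N}"
      unfolding new_label_eq by (subst (2) verts_eq) (use card_verts_ge in auto)
    finally show ?thesis
      using card_verts_ge card_verts_le by (intro exI[of _ "Suc (card (verts G))"]) auto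
  qed
  {
    fix C assume "weight ?G C > 0"
    then consider "weight G C > 0" | "C \<noteq> {}" "C \<subseteq> S" by (auto split: if_splits)
    then have "C \<noteq> {} \<and> C \<subseteq> verts ?G \<and> (\<forall>x\<in>C. \<forall>y\<in>C. x \<noteq> y \<longrightarrow> {x, y} \<in> edges ?G)"
    proof cases
      case 1
      then show ?thesis using weight_posD[OF 1] by auto
    qed auto
  } note * = this
  fix C assume "weight ?G C > 0"
  from *[OF this] show "C \<noteq> {}" "C \<subseteq> verts ?G"
    "\<And>x y. x \<in> C \<Longrightarrow> y \<in> C \<Longrightarrow> x \<noteq> y \<Longrightarrow> {x, y} \<in> edges ?G" by blast+
next
  fix e assume "e \<in> edges (interact S G)"
  then show "e \<subseteq> verts (interact S G)" "card e = 2" using edgesD by auto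
next
  have fin: "finite S" "card S = N" using S by (auto simp: admissible_def)
  fix m :: nat assume m: "m \<ge> 1"
  show "(\<Sum>C\<in>cliques m (interact S G). weight (interact S G) C) = Suc (Suc n) * (N choose m)"
    using sum_cliques_interact[OF fin(1) m, of "\<lambda>_. 1"] total_weight[OF m] fin
    by (simp add: n_subsets)
  fix j
  show "(\<Sum>C\<in>cliques m (interact S G). weight (interact S G) C * of_bool (j \<in> C))
    = (N - 1 choose (m - 1)) * weight (interact S G) {j}"
    unfolding sum_cliques_interact[OF fin(1) m] total_weight_containing[OF m]
      sum_subsets_of_bool[OF fin(1) m] by (simp add: fin)
next
  fix j assume "j \<in> verts (interact S G)"
  then show "1 \<le> weight (interact S G) {j}" using weight_vertex_pos[of j] by auto
next
  fix j
  show "weight (interact S G) {j} \<le> Suc (Suc n)" using weight_vertex_le[of j] by simp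
next
  fix j
  have fin: "finite S" "card S = N" using S by (auto simp: admissible_def)
  show "degree_in (interact S G) j \<le> (N - 1) * weight (interact S G) {j}"
    using degree_in_mono_bound(2)[OF fin finite_nbrs, of j] degree_le_weight[of j] N
    by (cases N; cases "j \<in> S") auto
qed

end

lemma model_graph_initial:
  assumes "N \<ge> 3"
  shows "model_graph N 0 (initial_graph N)"
proof -
  let ?V = "{1 - int N..0}" and ?G = "initial_graph N"
  have G: "verts ?G = ?V" "edges ?G = {e. e \<subseteq> ?V \<and> card e = 2}"
    "\<And>C. weight ?G C = (if C \<noteq> {} \<and> C \<subseteq> ?V then 1 else 0)"
    by (auto simp: initial_graph_def Let_def)
  have cliques: "cliques m ?G = {C. C \<subseteq> ?V \<and> card C = m}" for m
    by (auto simp: cliques_def G card_2_iff)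
  have w1: "(\<Sum>C\<in>cliques m ?G. weight ?G C * f C) = (\<Sum>C | C \<subseteq> ?V \<and> card C = m. f C)"
    if "m \<ge> 1" for m and f :: "int set \<Rightarrow> nat"
    unfolding cliques using that by (intro sum.cong) (auto simp: G)
  have deg: "degree_in ?G j \<le> (N - 1) * weight ?G {j}" for j
  proof (cases "j \<in> ?V")
    case True
    have "{i. {i, j} \<in> edges ?G} \<subseteq> ?V - {j}" by (auto simp: G card_2_iff)
    then have "degree_in ?G j \<le> card (?V - {j})" unfolding degree_in_def by (intro card_mono) auto
    also have "\<dots> = N - 1" using True by (simp add: card_Diff_singleton)
    finally show ?thesis using True by (simp add: G)
  next
    case False
    then have "{i. {i, j} \<in> edges ?G} = {}" by (auto simp: G)
    then show ?thesis by (simp add: degree_in_def)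
  qed
  show ?thesis
    unfolding model_graph_def
  proof (intro conjI allI ballI impI)
    show "\<exists>V\<ge>N. verts ?G = {1 - int N..int V - int N} \<and> V \<le> N + 0"
      by (intro exI[of _ N]) (simp add: G)
    fix m :: nat assume m: "1 \<le> m"
    show "(\<Sum>C\<in>cliques m ?G. weight ?G C) = Suc 0 * (N choose m)"
      using w1[OF m, of "\<lambda>_. 1"] by (simp add: n_subsets)
    show "(\<Sum>C\<in>cliques m ?G. weight ?G C * of_bool (j \<in> C)) = (N - 1 choose (m - 1)) * weight ?G {j}" for j
      unfolding w1[OF m] by (subst sum_subsets_of_bool[OF _ m]) (auto simp: G)
  qed (use deg in \<open>auto simp: G card_2_iff split: if_splits\<close>)
qed

section \<open>Law and expectations of a single step, given the graph\<close>

locale interaction_params =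
  fixes N :: nat and p q r :: real
  assumes N_ge: "N \<ge> 3" and p_pos: "0 < p" and p_le: "p \<le> 1"
    and q_bounds: "0 \<le> q" "q \<le> 1" and r_bounds: "0 \<le> r" "r \<le> 1"
begin

abbreviation \<alpha> :: real where "\<alpha> \<equiv> alpha N p q r"

abbreviation E_step :: "wgraph \<Rightarrow> (int set \<Rightarrow> real) \<Rightarrow> real" where
  "E_step G f \<equiv> measure_pmf.expectation (interaction_pmf N p q r G) f"

text \<open>The expected number of old vertices that are picked uniformly in one step. Divided by
  the number of vertices, it is the probability that a given old vertex is picked in this
  way.\<close>

definition uniform_rate :: real where
  "uniform_rate = p * (1 - r) * (real N - 1) + (1 - p) * (1 - q) * real N"

lemma alpha2_nonneg: "alpha2 N p r \<ge> 0"
  unfolding alpha2_def using N_ge p_pos r_bounds by simp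

lemma alpha2_le: "alpha2 N p r \<le> \<alpha>"
  unfolding alpha_def alpha1_def using p_le q_bounds by simp

lemma alpha_le_1: "\<alpha> \<le> 1"
proof -
  have "(1 - p) * q \<le> (1 - p) * 1" using p_le q_bounds by (intro mult_left_mono) auto
  moreover have "(real N - 1) / real N * p * r \<le> 1 * p * 1"
    using N_ge p_pos r_bounds by (intro mult_mono) auto
  ultimately show ?thesis unfolding alpha_def alpha1_def alpha2_def by simp
qed

lemma uniform_rate_bounds: "0 \<le> uniform_rate" "uniform_rate \<le> real N"
proof -
  show "0 \<le> uniform_rate"
    unfolding uniform_rate_def using N_ge p_pos p_le q_bounds r_bounds by simp
  have "p * (1 - r) * (real N - 1) \<le> p * 1 * real N"
    using N_ge p_pos r_bounds by (intro mult_mono) auto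
  moreover have "(1 - p) * (1 - q) * real N \<le> (1 - p) * 1 * real N"
    using N_ge p_le q_bounds by (intro mult_mono) auto
  ultimately show "uniform_rate \<le> real N"
    unfolding uniform_rate_def by (simp add: algebra_simps)
qed

context
  fixes n :: nat and G :: wgraph
  assumes G: "model_graph N n G"
begin

abbreviation "V \<equiv> card (verts G)"

lemma total_weight_real:
  assumes "m \<ge> 1"
  shows "(\<Sum>C\<in>cliques m G. real (weight G C)) = real (Suc n) * real (N choose m)"
  using total_weight[OF N_ge G assms] by (metis of_nat_sum of_nat_mult)

text \<open>\<open>embed_pmf\<close> has the intended values only for a normalised function.
  Normalisation is possible because the invariant makes the total weight positive for
  \<open>m \<le> N\<close>.\<close>

lemma pmf_weighted_clique:
  assumes "1 \<le> m" "m \<le> N"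
  shows "pmf (weighted_clique_pmf m G) C =
    (if C \<in> cliques m G then real (weight G C) / (\<Sum>H\<in>cliques m G. real (weight G H)) else 0)"
  unfolding weighted_clique_pmf_def
proof (rule pmf_embed_pmf)
  let ?T = "\<Sum>H\<in>cliques m G. real (weight G H)"
  let ?f = "\<lambda>C. if C \<in> cliques m G then real (weight G C) / ?T else 0"
  have T: "?T > 0" unfolding total_weight_real[OF assms(1)] using assms by simp
  show nonneg: "0 \<le> ?f C" for C using T by simp
  have fin: "finite (cliques m G)" by (rule finite_cliques[OF N_ge G])
  have "(\<integral>\<^sup>+ C. ennreal (?f C) \<partial>count_space UNIV) = (\<Sum>C\<in>cliques m G. ennreal (?f C))"
    by (rule nn_integral_count_space'[OF fin]) auto
  also have "\<dots> = ennreal (\<Sum>C\<in>cliques m G. ?f C)" by (rule sum_ennreal) (rule nonneg)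
  also have "(\<Sum>C\<in>cliques m G. ?f C) = (\<Sum>C\<in>cliques m G. real (weight G C) / ?T)"
    by (intro sum.cong) auto
  also have "\<dots> = 1" using T by (simp add: sum_divide_distrib[symmetric])
  finally show "(\<integral>\<^sup>+ C. ennreal (?f C) \<partial>count_space UNIV) = 1" by simp
qed

lemma set_weighted_clique:
  assumes "1 \<le> m" "m \<le> N"
  shows "set_pmf (weighted_clique_pmf m G) \<subseteq> cliques m G"
  using pmf_weighted_clique[OF assms] by (auto simp: set_pmf_eq split: if_splits)

lemma expectation_weighted_clique:
  fixes f :: "int set \<Rightarrow> real"
  assumes "1 \<le> m" "m \<le> N"
  shows "measure_pmf.expectation (weighted_clique_pmf m G) f
    = (\<Sum>C\<in>cliques m G. real (weight G C) * f C) / (real (Suc n) * real (N choose m))"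
proof -
  have "measure_pmf.expectation (weighted_clique_pmf m G) f
      = (\<Sum>C\<in>cliques m G. f C * pmf (weighted_clique_pmf m G) C)"
    using set_weighted_clique[OF assms] finite_cliques[OF N_ge G]
    by (intro integral_measure_pmf_real) auto
  also have "\<dots> = (\<Sum>C\<in>cliques m G. real (weight G C) * f C / (real (Suc n) * real (N choose m)))"
    by (intro sum.cong refl) (simp add: pmf_weighted_clique[OF assms] total_weight_real[OF assms(1)])
  finally show ?thesis by (simp add: sum_divide_distrib)
qed

lemma subsets_nonempty:
  assumes "m \<le> N"
  shows "{S. S \<subseteq> verts G \<and> card S = m} \<noteq> {}" "finite {S. S \<subseteq> verts G \<and> card S = m}"
    "card {S. S \<subseteq> verts G \<and> card S = m} = V choose m"
proof -
  have "m \<le> V" using card_verts_ge[OF N_ge G] assms by simp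
  from obtain_subset_with_card_n[OF this]
  show "{S. S \<subseteq> verts G \<and> card S = m} \<noteq> {}" by blast
  show "finite {S. S \<subseteq> verts G \<and> card S = m}"
    using finite_verts[OF N_ge G] by simp
  show "card {S. S \<subseteq> verts G \<and> card S = m} = V choose m"
    by (rule n_subsets[OF finite_verts[OF N_ge G]])
qed

lemma set_uniform_subset:
  "m \<le> N \<Longrightarrow> set_pmf (uniform_subset_pmf m G) = {S. S \<subseteq> verts G \<and> card S = m}"
  unfolding uniform_subset_pmf_def by (rule set_pmf_of_set) (use subsets_nonempty in auto)

lemma expectation_uniform_member:
  assumes "m \<le> N" "m \<ge> 1" "j \<in> verts G"
  shows "measure_pmf.expectation (uniform_subset_pmf m G) (\<lambda>S. of_bool (j \<in> S) :: real) = real m / real V"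
proof -
  have Vm: "V \<ge> m" "V \<ge> 1" using card_verts_ge[OF N_ge G] assms by auto
  have "measure_pmf.expectation (uniform_subset_pmf m G) (\<lambda>S. of_bool (j \<in> S) :: real)
     = (\<Sum>S | S \<subseteq> verts G \<and> card S = m. of_bool (j \<in> S)) / real (V choose m)"
    unfolding uniform_subset_pmf_def subsets_nonempty(3)[OF assms(1), symmetric]
    by (rule integral_pmf_of_set) (use subsets_nonempty[OF assms(1)] in auto)
  also have "(\<Sum>S | S \<subseteq> verts G \<and> card S = m. of_bool (j \<in> S) :: real)
     = real (\<Sum>S | S \<subseteq> verts G \<and> card S = m. of_bool (j \<in> S) :: nat)" by simp
  also have "\<dots> = real (V - 1 choose (m - 1))"
    unfolding sum_subsets_of_bool[OF finite_verts[OF N_ge G] assms(2)] using assms(3) by simp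
  also have "real (V - 1 choose (m - 1)) = real m / real V * real (V choose m)"
  proof -
    have "real m * real (V choose m) = real V * real (V - 1 choose (m - 1))"
      using times_binomial_minus1_eq[of m V] assms(2) by (metis of_nat_mult not_one_le_zero neq0_conv)
    then show ?thesis using Vm by (simp add: field_simps)
  qed
  also have "\<dots> / real (V choose m) = real m / real V"
    using Vm by simp
  finally show ?thesis .
qed

text \<open>Finite support makes every function of the next interacting set integrable, so that
  \<open>E_step\<close> is linear and monotone without side conditions.\<close>

lemma finite_set_interaction: "finite (set_pmf (interaction_pmf N p q r G))"
  and set_interaction_admissible: "S \<in> set_pmf (interaction_pmf N p q r G) \<Longrightarrow> admissible N G S"
proof -
  let ?v = "new_label G"
  let ?A = "{C. C \<subseteq> verts G \<and> card C = N - 1}" and ?B = "{C. C \<subseteq> verts G \<and> card C = N}"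
  have sub: "set_pmf (interaction_pmf N p q r G) \<subseteq> insert ?v ` ?A \<union> ?B"
  proof -
    have cliques: "cliques m G \<subseteq> {C. C \<subseteq> verts G \<and> card C = m}" for m
      by (auto simp: cliques_def)
    have N1: "1 \<le> N" "N \<le> N" "1 \<le> N - 1" "N - 1 \<le> N" using N_ge by auto
    have "set_pmf (weighted_clique_pmf (N - 1) G) \<subseteq> ?A" "set_pmf (weighted_clique_pmf N G) \<subseteq> ?B"
      "set_pmf (uniform_subset_pmf (N - 1) G) = ?A" "set_pmf (uniform_subset_pmf N G) = ?B"
      using order_trans[OF set_weighted_clique[OF N1(3,4)] cliques]
        order_trans[OF set_weighted_clique[OF N1(1,2)] cliques]
        set_uniform_subset[OF N1(2)] set_uniform_subset[OF N1(4)] by blast+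
    then show ?thesis
      unfolding interaction_pmf_def set_bind_pmf set_map_pmf
      by (fastforce split: if_splits simp del: One_nat_def)
  qed
  show "finite (set_pmf (interaction_pmf N p q r G))"
    by (rule finite_subset[OF sub]) (simp add: finite_verts[OF N_ge G])
  assume "S \<in> set_pmf (interaction_pmf N p q r G)"
  with sub consider C where "C \<in> ?A" "S = insert ?v C" | "S \<in> ?B" by blast
  then show "admissible N G S"
  proof cases
    case 1
    then have "finite C" "?v \<notin> C"
      using finite_verts[OF N_ge G] finite_subset new_label_notin[OF N_ge G] by blast+
    then show ?thesis using 1 N_ge unfolding admissible_def by auto
  next
    case 2
    then show ?thesis using finite_subset[OF _ finite_verts[OF N_ge G]] unfolding admissible_def by blast
  qed
qed

lemma E_step_eq:
  "E_step G f =
     p * (r * measure_pmf.expectation (weighted_clique_pmf (N - 1) G) (\<lambda>C. f (insert (new_label G) C))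
        + (1 - r) * measure_pmf.expectation (uniform_subset_pmf (N - 1) G) (\<lambda>C. f (insert (new_label G) C)))
     + (1 - p) * (q * measure_pmf.expectation (weighted_clique_pmf N G) f
        + (1 - q) * measure_pmf.expectation (uniform_subset_pmf N G) f)"
proof -
  let ?v = "new_label G"
  have fin: "finite (set_pmf (weighted_clique_pmf m G))" "finite (set_pmf (uniform_subset_pmf m G))"
    if "1 \<le> m" "m \<le> N" for m
    using finite_subset[OF set_weighted_clique[OF that] finite_cliques[OF N_ge G]]
      set_uniform_subset[OF that(2)] subsets_nonempty(2)[OF that(2)] by simp_all
  have N1: "1 \<le> N" "N \<le> N" "1 \<le> N - 1" "N - 1 \<le> N" using N_ge by auto
  note fins = fin[OF N1(1,2)] fin[OF N1(3,4)]
  have bern: "measure_pmf.expectation (bernoulli_pmf x \<bind> g) h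
     = x * measure_pmf.expectation (g True) h + (1 - x) * measure_pmf.expectation (g False) h"
    if "0 \<le> x" "x \<le> 1" "\<And>b. finite (set_pmf (g b))" for x :: real and g and h :: "int set \<Rightarrow> real"
    using that by (subst pmf_expectation_bind[of UNIV]) (auto simp: UNIV_bool)
  show ?thesis
    unfolding interaction_pmf_def
    by (subst bern, use p_pos p_le fins in \<open>auto simp: bern[OF r_bounds] bern[OF q_bounds] fins\<close>)
qed

lemma E_step_mono:
  assumes "\<And>S. admissible N G S \<Longrightarrow> f S \<le> g S"
  shows "E_step G f \<le> E_step G g"
  using finite_set_interaction set_interaction_admissible assms
  by (intro integral_mono_AE integrable_measure_pmf_finite) (auto simp: AE_measure_pmf_iff)

lemma E_step_cong:
  assumes "\<And>S. admissible N G S \<Longrightarrow> f S = g S"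
  shows "E_step G f = E_step G g"
  by (intro antisym E_step_mono) (simp_all add: assms)

lemma E_step_add: "E_step G (\<lambda>S. f S + g S) = E_step G f + E_step G g"
  and E_step_diff: "E_step G (\<lambda>S. f S - g S) = E_step G f - E_step G g"
  and E_step_cmult: "E_step G (\<lambda>S. c * f S) = c * E_step G f"
  and E_step_divide: "E_step G (\<lambda>S. f S / c) = E_step G f / c"
  and E_step_const: "E_step G (\<lambda>S. c) = c"
  and E_step_sum: "E_step G (\<lambda>S. \<Sum>i\<in>A. h i S) = (\<Sum>i\<in>A. E_step G (h i))"
  using finite_set_interaction by (auto simp: integrable_measure_pmf_finite)

text \<open>The quotient of the two clique sums of the invariant, with (N - 1 choose m - 1) / (N
  choose m) = m / N. The case \<open>m = N - 1\<close> is the origin of the factor (N - 1) / N in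
  \<open>alpha2\<close>.\<close>

lemma expectation_weighted_member:
  assumes "1 \<le> m" "m \<le> N"
  shows "measure_pmf.expectation (weighted_clique_pmf m G) (\<lambda>C. of_bool (j \<in> C))
     = real m / real N * real (weight G {j}) / real (Suc n)"
proof -
  have sum: "(\<Sum>C\<in>cliques m G. real (weight G C) * of_bool (j \<in> C))
     = real (N - 1 choose (m - 1)) * real (weight G {j})"
    unfolding of_nat_mult[symmetric] total_weight_containing[OF N_ge G assms(1), symmetric] by simp
  have "real m * real (N choose m) = real N * real (N - 1 choose (m - 1))"
    using times_binomial_minus1_eq[of m N] assms(1) by (metis of_nat_mult not_one_le_zero neq0_conv)
  moreover have "real (N choose m) > 0" using assms by simp
  ultimately have "real (N - 1 choose (m - 1)) / real (N choose m) = real m / real N"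
    using N_ge by (simp add: field_simps)
  then show ?thesis
    unfolding expectation_weighted_clique[OF assms] sum
    by (metis (no_types, lifting) mult.commute times_divide_times_eq times_divide_eq_left)
qed

lemma E_step_member:
  assumes j: "j \<in> verts G"
  shows "E_step G (\<lambda>S. of_bool (j \<in> S))
     = \<alpha> * real (weight G {j}) / real (Suc n) + uniform_rate / real V"
proof -
  have v: "j \<noteq> new_label G" using j new_label_notin[OF N_ge G] by auto
  have N1: "1 \<le> N" "N \<le> N" "1 \<le> N - 1" "N - 1 \<le> N" using N_ge by auto
  have "E_step G (\<lambda>S. of_bool (j \<in> S))
    = p * (r * ((real N - 1) / real N * real (weight G {j}) / real (Suc n))
        + (1 - r) * ((real N - 1) / real V))
      + (1 - p) * (q * (real (weight G {j}) / real (Suc n)) + (1 - q) * (real N / real V))"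
    unfolding E_step_eq using v N_ge
    by (simp add: expectation_weighted_member[OF N1(1,2)] expectation_weighted_member[OF N1(3,4)] expectation_uniform_member[OF N1(2,1) j]
        expectation_uniform_member[OF N1(4,3) j] of_nat_diff del: One_nat_def)
  \<comment> \<open>Collecting the coefficients of W / (n + 1) and of 1 / V over the four cases
    produces alpha and \<open>uniform_rate\<close>.\<close>
  moreover have "p * (r * (c * x) + (1 - r) * (k * y)) + (1 - p) * (q * x + (1 - q) * (l * y))
    = ((1 - p) * q + c * p * r) * x + (p * (1 - r) * k + (1 - p) * (1 - q) * l) * y"
    for c x y k l :: real by (simp add: algebra_simps)
  from this[of "(real N - 1) / real N" "real (weight G {j}) / real (Suc n)" "real N - 1" "1 / real V" "real N"]
  have "p * (r * ((real N - 1) / real N * real (weight G {j}) / real (Suc n))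
        + (1 - r) * ((real N - 1) / real V))
      + (1 - p) * (q * (real (weight G {j}) / real (Suc n)) + (1 - q) * (real N / real V))
    = \<alpha> * real (weight G {j}) / real (Suc n) + uniform_rate / real V"
    unfolding alpha_def alpha1_def alpha2_def uniform_rate_def by simp
  ultimately show ?thesis by simp
qed

lemma E_step_new_vertex:
  "E_step G (\<lambda>S. real (card (verts G \<union> S)) - real V) = p"
proof -
  have fin: "finite (verts G)" by (rule finite_verts[OF N_ge G])
  have N1: "1 \<le> N" "N \<le> N" "1 \<le> N - 1" "N - 1 \<le> N" using N_ge by auto
  have "measure_pmf.expectation K
       (\<lambda>C. real (card (verts G \<union> insert (new_label G) C)) - real V) = 1"
    "measure_pmf.expectation K (\<lambda>C. real (card (verts G \<union> C)) - real V) = 0"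
    if "set_pmf K \<subseteq> Pow (verts G)" for K
  proof -
    have V1: "card (insert (new_label G) (verts G)) = Suc V"
      using fin new_label_notin[OF N_ge G] by simp
    have *: "verts G \<union> insert (new_label G) C = insert (new_label G) (verts G)" "verts G \<union> C = verts G"
      if "C \<in> set_pmf K" for C
    proof -
      have "C \<subseteq> verts G" using that \<open>set_pmf K \<subseteq> _\<close> by auto
      then show "verts G \<union> C = verts G" by auto
      then show "verts G \<union> insert (new_label G) C = insert (new_label G) (verts G)" by auto
    qed
    have "measure_pmf.expectation K
       (\<lambda>C. real (card (verts G \<union> insert (new_label G) C)) - real V) = measure_pmf.expectation K (\<lambda>_. 1)"
      by (intro integral_cong_AE) (simp_all add: AE_measure_pmf_iff * V1)
    then show "measure_pmf.expectation K
       (\<lambda>C. real (card (verts G \<union> insert (new_label G) C)) - real V) = 1" by simp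
    have "measure_pmf.expectation K (\<lambda>C. real (card (verts G \<union> C)) - real V)
       = measure_pmf.expectation K (\<lambda>_. 0)"
      by (intro integral_cong_AE) (simp_all add: AE_measure_pmf_iff * V1)
    then show "measure_pmf.expectation K (\<lambda>C. real (card (verts G \<union> C)) - real V) = 0" by simp
  qed note K = this
  have "set_pmf (weighted_clique_pmf m G) \<subseteq> Pow (verts G)"
       "set_pmf (uniform_subset_pmf m G) \<subseteq> Pow (verts G)" if "1 \<le> m" "m \<le> N" for m
    using set_weighted_clique[OF that] set_uniform_subset[OF that(2)] by (auto simp: cliques_def)
  from K[OF this(1)[OF N1(1,2)]] K[OF this(1)[OF N1(3,4)]]
    K[OF this(2)[OF N1(1,2)]] K[OF this(2)[OF N1(3,4)]]
  show ?thesis unfolding E_step_eq by (simp add: algebra_simps)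
qed

lemma degree_increment_bounds:
  assumes "admissible N G S"
  shows "degree_in G j \<le> degree_in (interact S G) j"
    and "degree_in (interact S G) j \<le> degree_in G j + (N - 1) * of_bool (j \<in> S)"
  using degree_in_mono_bound[OF _ _ finite_nbrs[OF N_ge G], of S N j] assms N_ge
  unfolding admissible_def by auto

lemma degree_in_old_clique:
  assumes "C \<in> cliques m G"
  shows "degree_in (interact C G) j = degree_in G j"
proof -
  have "{i. {i, j} \<in> edges (interact C G)} = {i. {i, j} \<in> edges G}"
    using assms by (auto simp: cliques_def card_2_iff doubleton_eq_iff)
  then show ?thesis by (simp add: degree_in_def)
qed

lemma degree_in_new_vertex:
  assumes "C \<in> cliques m G" "j \<in> verts G"
  shows "degree_in (interact (insert (new_label G) C) G) j = degree_in G j + of_bool (j \<in> C)"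
proof -
  let ?v = "new_label G"
  have v: "?v \<notin> verts G" by (rule new_label_notin[OF N_ge G])
  have C: "C \<subseteq> verts G" using assms by (auto simp: cliques_def)
  have jv: "j \<noteq> ?v" using assms v by auto
  have "{i. {i, j} \<in> edges (interact (insert ?v C) G)}
     = {i. {i, j} \<in> edges G} \<union> (if j \<in> C then {?v} else {})"
    using assms jv by (auto simp: cliques_def card_2_iff doubleton_eq_iff)
  moreover have "?v \<notin> {i. {i, j} \<in> edges G}"
    using edgesD[OF N_ge G] v by blast
  ultimately show ?thesis
    using finite_nbrs[OF N_ge G, of j] by (simp add: degree_in_def)
qed

text \<open>The preferential part is exact: an old N-clique brings no new neighbour, and an old
  (N-1)-clique brings each member the new vertex. A uniform choice that contains \<open>j\<close>
  brings between 0 and N - 1 new neighbours, depending on the edges already present, which leaves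
  the gap between the two bounds.\<close>

lemma E_step_degree:
  assumes j: "j \<in> verts G"
  shows "alpha2 N p r * real (weight G {j}) / real (Suc n)
      \<le> E_step G (\<lambda>S. real (degree_in (interact S G) j) - real (degree_in G j))"
    and "E_step G (\<lambda>S. real (degree_in (interact S G) j) - real (degree_in G j))
      \<le> alpha2 N p r * real (weight G {j}) / real (Suc n) + real N * uniform_rate / real V"
proof -
  let ?v = "new_label G" and ?g = "\<lambda>S. real (degree_in (interact S G) j) - real (degree_in G j)"
  have N1: "1 \<le> N" "N \<le> N" "1 \<le> N - 1" "N - 1 \<le> N" using N_ge by auto
  have "measure_pmf.expectation (weighted_clique_pmf (N - 1) G) (\<lambda>C. ?g (insert ?v C))
      = measure_pmf.expectation (weighted_clique_pmf (N - 1) G) (\<lambda>C. of_bool (j \<in> C))"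
    using set_weighted_clique[OF N1(3,4)] j
    by (intro integral_cong_AE) (auto simp: AE_measure_pmf_iff degree_in_new_vertex)
  then have w1: "measure_pmf.expectation (weighted_clique_pmf (N - 1) G) (\<lambda>C. ?g (insert ?v C))
      = (real N - 1) / real N * real (weight G {j}) / real (Suc n)"
    using expectation_weighted_member[OF N1(3,4)] N_ge by (simp add: of_nat_diff del: One_nat_def)
  have "measure_pmf.expectation (weighted_clique_pmf N G) ?g
      = measure_pmf.expectation (weighted_clique_pmf N G) (\<lambda>_. 0)"
    using set_weighted_clique[OF N1(1,2)]
    by (intro integral_cong_AE) (auto simp: AE_measure_pmf_iff degree_in_old_clique)
  then have w2: "measure_pmf.expectation (weighted_clique_pmf N G) ?g = 0" by simp
  \<comment> \<open>A uniform m-subset contains \<open>j\<close> with probability m / V, and the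
    gain is at most N - 1 then and 0 otherwise.\<close>
  have unif: "0 \<le> measure_pmf.expectation (uniform_subset_pmf m G) f
      \<and> measure_pmf.expectation (uniform_subset_pmf m G) f \<le> (real N - 1) * (real m / real V)"
    if m: "1 \<le> m" "m \<le> N"
      and f: "\<And>C. C \<subseteq> verts G \<Longrightarrow> card C = m \<Longrightarrow> 0 \<le> f C \<and> f C \<le> (real N - 1) * of_bool (j \<in> C)"
    for m f
  proof -
    have fin: "finite (set_pmf (uniform_subset_pmf m G))"
      unfolding set_uniform_subset[OF m(2)] by (rule subsets_nonempty(2)[OF m(2)])
    have "0 \<le> measure_pmf.expectation (uniform_subset_pmf m G) f"
      by (intro integral_nonneg_AE) (auto simp: AE_measure_pmf_iff set_uniform_subset[OF m(2)] f)
    moreover have "measure_pmf.expectation (uniform_subset_pmf m G) f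
       \<le> measure_pmf.expectation (uniform_subset_pmf m G) (\<lambda>C. (real N - 1) * of_bool (j \<in> C))"
      by (intro integral_mono_AE integrable_measure_pmf_finite fin)
         (use f in \<open>auto simp: AE_measure_pmf_iff set_uniform_subset[OF m(2)]\<close>)
    ultimately show ?thesis
      using expectation_uniform_member[OF m(2,1) j] by simp
  qed
  have bd: "0 \<le> ?g S \<and> ?g S \<le> (real N - 1) * of_bool (j \<in> S)" if "admissible N G S" for S
  proof -
    have "real (degree_in (interact S G) j) \<le> real (degree_in G j + (N - 1) * of_bool (j \<in> S))"
      using degree_increment_bounds(2)[OF that] by (rule of_nat_mono)
    then show ?thesis using degree_increment_bounds(1)[OF that, of j] N_ge
      by (simp add: of_nat_diff algebra_simps del: One_nat_def)
  qed
  have u1: "0 \<le> measure_pmf.expectation (uniform_subset_pmf (N - 1) G) (\<lambda>C. ?g (insert ?v C)) \<and>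
     measure_pmf.expectation (uniform_subset_pmf (N - 1) G) (\<lambda>C. ?g (insert ?v C))
       \<le> (real N - 1) * (real (N - 1) / real V)"
  proof (rule unif[OF N1(3,4)])
    fix C assume C: "C \<subseteq> verts G" "card C = N - 1"
    then have "finite C" "?v \<notin> C"
      using finite_verts[OF N_ge G] finite_subset new_label_notin[OF N_ge G] by blast+
    then have "admissible N G (insert ?v C)"
      using C N_ge unfolding admissible_def by auto
    have eq: "j \<in> insert ?v C \<longleftrightarrow> j \<in> C" using j new_label_notin[OF N_ge G] by auto
    from bd[OF \<open>admissible N G (insert ?v C)\<close>, unfolded eq] show "0 \<le> ?g (insert ?v C) \<and> ?g (insert ?v C) \<le> (real N - 1) * of_bool (j \<in> C)" .
  qed
  have u2: "0 \<le> measure_pmf.expectation (uniform_subset_pmf N G) ?g \<and>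
     measure_pmf.expectation (uniform_subset_pmf N G) ?g \<le> (real N - 1) * (real N / real V)"
  proof (rule unif[OF N1(1,2)])
    fix C assume C: "C \<subseteq> verts G" "card C = N"
    then have "admissible N G C"
      using finite_subset[OF _ finite_verts[OF N_ge G]] unfolding admissible_def by auto
    from bd[OF this] show "0 \<le> ?g C \<and> ?g C \<le> (real N - 1) * of_bool (j \<in> C)" .
  qed
  define U1 where "U1 = measure_pmf.expectation (uniform_subset_pmf (N - 1) G) (\<lambda>C. ?g (insert ?v C))"
  define U2 where "U2 = measure_pmf.expectation (uniform_subset_pmf N G) ?g"
  have E: "E_step G ?g = alpha2 N p r * real (weight G {j}) / real (Suc n)
      + (p * (1 - r) * U1 + (1 - p) * (1 - q) * U2)"
    unfolding E_step_eq w1 w2 U1_def[symmetric] U2_def[symmetric] alpha2_def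
    by (simp add: distrib_left)
  have "0 \<le> p * (1 - r) * U1 + (1 - p) * (1 - q) * U2"
    using u1 u2 p_pos p_le q_bounds r_bounds unfolding U1_def U2_def by simp
  then show "alpha2 N p r * real (weight G {j}) / real (Suc n) \<le> E_step G ?g" using E by simp
  have "p * (1 - r) * U1 + (1 - p) * (1 - q) * U2
     \<le> p * (1 - r) * ((real N - 1) * (real (N - 1) / real V)) + (1 - p) * (1 - q) * ((real N - 1) * (real N / real V))"
    using u1 u2 p_pos p_le q_bounds r_bounds unfolding U1_def U2_def
    by (intro add_mono mult_left_mono) auto
  also have "\<dots> = (real N - 1) * (uniform_rate / real V)"
  proof -
    have "p * (1 - r) * (k * (k * y)) + (1 - p) * (1 - q) * (k * (l * y))
      = k * ((p * (1 - r) * k + (1 - p) * (1 - q) * l) * y)" for k l y :: real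
      by (simp add: algebra_simps)
    from this[of "real N - 1" "1 / real V" "real N"] show ?thesis
      using N_ge unfolding uniform_rate_def by (simp add: of_nat_diff del: One_nat_def)
  qed
  also have "\<dots> \<le> real N * (uniform_rate / real V)"
    using uniform_rate_bounds by (intro mult_right_mono) auto
  finally show "E_step G ?g \<le> alpha2 N p r * real (weight G {j}) / real (Suc n) + real N * uniform_rate / real V"
    using E by simp
qed

end
end

section \<open>Histories and almost sure convergence\<close>

text \<open>A finite list makes the past a single element of a countable set, and a step appends one
  element at its end.\<close>

definition graph_of :: "nat \<Rightarrow> int set list \<Rightarrow> wgraph" where
  "graph_of N h = foldl (\<lambda>G S. interact S G) (initial_graph N) h"

lemma graph_of_Nil [simp]: "graph_of N [] = initial_graph N"
  and graph_of_snoc [simp]: "graph_of N (h @ [S]) = interact S (graph_of N h)"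
  by (simp_all add: graph_of_def)

lemma graph_after_eq: "graph_after N f n = graph_of N (map (\<lambda>k. f (Suc k)) [0..<n])"
  by (induction n) simp_all

section \<open>The law of the history up to a fixed time\<close>

locale nondegenerate_model = N_interactions_model M N p q r I + interaction_params N p q r
  for M :: "'a measure" and N :: nat and p q r :: real and I :: "nat \<Rightarrow> 'a \<Rightarrow> int set"
begin

definition hist :: "nat \<Rightarrow> 'a \<Rightarrow> int set list" where
  "hist n \<omega> = map (\<lambda>k. I (Suc k) \<omega>) [0..<n]"

lemma length_hist [simp]: "length (hist n \<omega>) = n"
  by (simp add: hist_def)

lemma hist_0 [simp]: "hist 0 \<omega> = []"
  by (simp add: hist_def)

lemma hist_Suc: "hist (Suc n) \<omega> = hist n \<omega> @ [I (Suc n) \<omega>]"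
  by (simp add: hist_def)

lemma take_hist: "k \<le> n \<Longrightarrow> take k (hist n \<omega>) = hist k \<omega>"
  by (simp add: hist_def take_map)

lemma nth_hist: "k < n \<Longrightarrow> hist n \<omega> ! k = I (Suc k) \<omega>"
  by (simp add: hist_def)

abbreviation graph_h :: "int set list \<Rightarrow> wgraph" where
  "graph_h \<equiv> graph_of N"

lemma hist_eq_iff:
  assumes "length h = n"
  shows "hist n \<omega> = h \<longleftrightarrow> (\<forall>k\<in>{..<n}. I (Suc k) \<omega> = h ! k)"
  unfolding list_eq_iff_nth_eq[of "hist n \<omega>" h] using assms by (simp add: nth_hist lessThan_def)

lemma graph_after_hist: "graph_after N (\<lambda>k. I k \<omega>) n = graph_h (hist n \<omega>)"
  by (simp add: graph_after_eq hist_def)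

text \<open>The Markov chain of histories, built from the transition law alone;
  \<open>prob_hist\<close> identifies it as the law of \<open>hist\<close>. It has finite support,
  so that expectations over histories are finite sums.\<close>

primrec hist_pmf :: "nat \<Rightarrow> int set list pmf" where
  "hist_pmf 0 = return_pmf []"
| "hist_pmf (Suc n) =
     bind_pmf (hist_pmf n) (\<lambda>h. map_pmf (\<lambda>S. h @ [S]) (interaction_pmf N p q r (graph_h h)))"

abbreviation reachable :: "nat \<Rightarrow> int set list set" where
  "reachable n \<equiv> set_pmf (hist_pmf n)"

lemma reachable_model_graph: "h \<in> reachable n \<Longrightarrow> model_graph N n (graph_h h)"
  and reachable_length: "h \<in> reachable n \<Longrightarrow> length h = n"
proof (induction n arbitrary: h)
  case 0
  { case 1 then show ?case using model_graph_initial[OF N_ge] by simp }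
  { case 2 then show ?case by simp }
next
  case (Suc n)
  { case 1
    then obtain h' S where h': "h' \<in> reachable n" "S \<in> set_pmf (interaction_pmf N p q r (graph_h h'))"
      and h: "h = h' @ [S]" by auto
    note G = Suc.IH(1)[OF h'(1)]
    show ?case unfolding h graph_of_snoc
      by (rule model_graph_interact[OF N_ge G set_interaction_admissible[OF G h'(2)]]) }
  { case 2 then show ?case using Suc.IH(2) by auto }
qed

lemma finite_reachable: "finite (reachable n)"
proof (induction n)
  case (Suc n)
  show ?case
    unfolding hist_pmf.simps set_bind_pmf set_map_pmf
    by (intro finite_UN_I Suc finite_imageI finite_set_interaction reachable_model_graph)
qed simp

abbreviation E_hist :: "nat \<Rightarrow> (int set list \<Rightarrow> real) \<Rightarrow> real" where
  "E_hist n F \<equiv> measure_pmf.expectation (hist_pmf n) F"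

lemma E_hist_Suc:
  "E_hist (Suc n) F = E_hist n (\<lambda>h. E_step (graph_h h) (\<lambda>S. F (h @ [S])))"
proof -
  have "E_hist (Suc n) F = (\<Sum>h\<in>reachable n. pmf (hist_pmf n) h *\<^sub>R
     measure_pmf.expectation (map_pmf (\<lambda>S. h @ [S]) (interaction_pmf N p q r (graph_h h))) F)"
    unfolding hist_pmf.simps
    by (rule pmf_expectation_bind[OF finite_reachable])
       (auto intro!: finite_imageI finite_set_interaction[OF reachable_model_graph])
  also have "\<dots> = (\<Sum>h\<in>reachable n. E_step (graph_h h) (\<lambda>S. F (h @ [S])) * pmf (hist_pmf n) h)"
    by (simp add: mult.commute)
  also have "\<dots> = E_hist n (\<lambda>h. E_step (graph_h h) (\<lambda>S. F (h @ [S])))"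
    by (rule integral_measure_pmf_real[OF finite_reachable, symmetric]) auto
  finally show ?thesis .
qed

lemma E_hist_mono:
  assumes "\<And>h. h \<in> reachable n \<Longrightarrow> F h \<le> F' h"
  shows "E_hist n F \<le> E_hist n F'"
  using assms finite_reachable
  by (intro integral_mono_AE integrable_measure_pmf_finite) (auto simp: AE_measure_pmf_iff)

lemma measurable_I [measurable]: "I (Suc n) \<in> measurable M (count_space UNIV)"
proof (rule measurableI)
  fix A :: "int set set"
  have "I (Suc n) -` (A \<inter> {S. finite S}) \<inter> space M \<in> sets M"
    by (rule measurable_sets[OF interacting_set_measurable]) auto
  moreover have "I (Suc n) -` (A \<inter> {S. finite S}) \<inter> space M = I (Suc n) -` A \<inter> space M"
    using measurable_space[OF interacting_set_measurable[of "Suc n"]] by auto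
  ultimately show "I (Suc n) -` A \<inter> space M \<in> sets M" by simp
qed simp

lemma finite_I: "\<omega> \<in> space M \<Longrightarrow> finite (I (Suc n) \<omega>)"
  using measurable_space[OF interacting_set_measurable[of "Suc n"]] by auto

text \<open>Finite lists of finite sets of integers form a countable set, which reduces
  measurability to the events of a single history.\<close>

lemma measurable_hist: "hist n \<in> measurable M (count_space UNIV)"
proof -
  let ?L = "lists {S :: int set. finite S}"
  have cnt: "countable ?L" by (intro countable_lists countable_Collect_finite)
  have "hist n \<in> measurable M (count_space ?L)"
    unfolding measurable_count_space_eq_countable[OF cnt]
  proof
    show "hist n \<in> space M \<rightarrow> ?L" using finite_I by (auto simp: hist_def)
    show "\<forall>h\<in>?L. hist n -` {h} \<inter> space M \<in> sets M"
    proof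
      fix h
      show "hist n -` {h} \<inter> space M \<in> sets M"
      proof (cases "length h = n")
        case True
        have "hist n -` {h} \<inter> space M = {\<omega> \<in> space M. \<forall>k\<in>{..<n}. I (Suc k) \<omega> = h ! k}"
          using hist_eq_iff[OF True] by blast
        also have "\<dots> \<in> sets M"
        proof (intro sets.sets_Collect_finite_All)
          fix k
          have "I (Suc k) -` {h ! k} \<inter> space M \<in> sets M"
            by (rule measurable_sets[OF measurable_I]) simp
          moreover have "I (Suc k) -` {h ! k} \<inter> space M = {\<omega> \<in> space M. I (Suc k) \<omega> = h ! k}"
            by auto
          ultimately show "{\<omega> \<in> space M. I (Suc k) \<omega> = h ! k} \<in> sets M" by simp
        qed simp
        finally show ?thesis .
      next
        case False
        then have "hist n -` {h} \<inter> space M = {}" by auto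
        then show ?thesis by simp
      qed
    qed
  qed
  note hist = this
  show ?thesis
  proof (rule measurableI)
    fix A
    have "hist n -` (A \<inter> ?L) \<inter> space M \<in> sets M"
      by (rule measurable_sets[OF hist]) auto
    moreover have "hist n -` (A \<inter> ?L) \<inter> space M = hist n -` A \<inter> space M"
      using measurable_space[OF hist] by auto
    ultimately show "hist n -` A \<inter> space M \<in> sets M" by simp
  qed simp
qed

lemma measurable_of_hist [measurable]:
  "(\<lambda>\<omega>. F (hist n \<omega>)) \<in> measurable M (count_space UNIV)"
  "(\<lambda>\<omega>. F' (hist n \<omega>) :: real) \<in> borel_measurable M"
  by (rule measurable_compose[OF measurable_hist], simp)+

text \<open>The model prescribes conditional probabilities only for pasts of positive probability;
  after a null past both sides of the equation vanish.\<close>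

lemma prob_hist: "prob {\<omega> \<in> space M. hist n \<omega> = h} = pmf (hist_pmf n) h"
proof (induction n arbitrary: h)
  case 0
  show ?case by (cases h) (simp_all add: prob_space pmf_return)
next
  case (Suc n)
  show ?case
  proof (cases h rule: rev_cases)
    case Nil
    have "{\<omega> \<in> space M. hist (Suc n) \<omega> = h} = {}" using Nil by (auto simp: hist_Suc)
    moreover have "h \<notin> reachable (Suc n)" using Nil by auto
    ultimately show ?thesis by (simp only: set_pmf_iff measure_empty not_not)
  next
    case (snoc h' S)
    let ?K = "interaction_pmf N p q r (graph_h h')"
    have "pmf (map_pmf (\<lambda>S. g @ [S]) (interaction_pmf N p q r (graph_h g))) h
        = (if g = h' then pmf ?K S else 0)" for g
    proof (cases "g = h'")
      case True
      have "inj (\<lambda>S. h' @ [S])" by (auto intro: injI)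
      from pmf_map_inj'[OF this] show ?thesis using True snoc by simp
    next
      case False
      then show ?thesis using snoc by (auto simp: pmf_eq_0_set_pmf)
    qed
    then have "pmf (hist_pmf (Suc n)) h = (\<integral>g. (if g = h' then pmf ?K S else 0) \<partial>measure_pmf (hist_pmf n))"
      by (simp add: pmf_bind)
    also have "\<dots> = (\<Sum>g\<in>{h'}. (if g = h' then pmf ?K S else 0) * pmf (hist_pmf n) g)"
      by (rule integral_measure_pmf_real) (auto split: if_splits)
    finally have pmf: "pmf (hist_pmf (Suc n)) h = pmf ?K S * pmf (hist_pmf n) h'" by simp
    let ?A = "{\<omega> \<in> space M. hist n \<omega> = h'}"
    have eq: "{\<omega> \<in> space M. hist (Suc n) \<omega> = h} = {\<omega> \<in> space M. I (Suc n) \<omega> = S \<and> hist n \<omega> = h'}"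
      using snoc by (auto simp: hist_Suc)
    show ?thesis
    proof (cases "prob ?A = 0")
      case True
      have "prob {\<omega> \<in> space M. hist (Suc n) \<omega> = h} \<le> prob ?A"
        unfolding eq by (intro finite_measure_mono) auto
      then have "prob {\<omega> \<in> space M. hist (Suc n) \<omega> = h} = 0"
        using True measure_nonneg[of M] by (metis order_antisym)
      then show ?thesis using True pmf Suc.IH by simp
    next
      case False
      then have pos: "prob ?A > 0" by (simp add: zero_less_measure_iff)
      then have "h' \<in> reachable n" using Suc.IH[of h'] by (simp add: set_pmf_iff)
      then have len: "length h' = n" by (rule reachable_length)
      \<comment> \<open>Steps are numbered from 1, list positions from 0.\<close>
      define f where "f k = h' ! (k - 1)" for k :: nat
      have hist_f: "(\<forall>k\<in>{1..n}. I k \<omega> = f k) \<longleftrightarrow> hist n \<omega> = h'" for \<omega>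
      proof -
        have "(\<forall>k\<in>{1..n}. I k \<omega> = f k) \<longleftrightarrow> (\<forall>k<n. I (Suc k) \<omega> = f (Suc k))"
          unfolding image_Suc_lessThan[symmetric] by auto
        then show ?thesis unfolding hist_eq_iff[OF len] by (simp add: f_def Ball_def)
      qed
      have "map (\<lambda>k. f (Suc k)) [0..<n] = h'"
        using len by (auto simp: f_def list_eq_iff_nth_eq)
      then have gr: "graph_after N f n = graph_h h'" by (simp add: graph_after_eq)
      have "\<P>(\<omega> in M. I (Suc n) \<omega> = S \<bar> hist n \<omega> = h') = pmf ?K S"
        using interacting_set_law[of n f S] pos unfolding hist_f gr by simp
      then have "prob {\<omega> \<in> space M. I (Suc n) \<omega> = S \<and> hist n \<omega> = h'} = pmf ?K S * prob ?A"
        using pos by (simp add: cond_prob_def field_simps)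
      then show ?thesis unfolding eq pmf using Suc.IH by simp
    qed
  qed
qed

text \<open>Almost every history lies in the finite set \<open>reachable n\<close>, so arbitrary
  sets reduce to finite ones, where the point probabilities add up.\<close>

lemma prob_hist_in:
  "prob {\<omega> \<in> space M. hist n \<omega> \<in> A} = measure_pmf.prob (hist_pmf n) A"
proof -
  have 1: "prob {\<omega> \<in> space M. hist n \<omega> \<in> B} = sum (pmf (hist_pmf n)) B"
    if "finite B" for B
    using that
  proof (induction B rule: finite_induct)
    case (insert h B)
    have "{\<omega> \<in> space M. hist n \<omega> \<in> insert h B}
        = {\<omega> \<in> space M. hist n \<omega> = h} \<union> {\<omega> \<in> space M. hist n \<omega> \<in> B}" by auto
    also have "prob \<dots> = prob {\<omega> \<in> space M. hist n \<omega> = h} + prob {\<omega> \<in> space M. hist n \<omega> \<in> B}"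
      by (intro finite_measure_Union) (use insert in auto)
    finally show ?case using insert by (simp add: prob_hist)
  qed simp
  have "prob {\<omega> \<in> space M. hist n \<omega> \<in> reachable n} = 1"
    unfolding 1[OF finite_reachable] using finite_reachable by (intro sum_pmf_eq_1) auto
  then have "AE \<omega> in M. hist n \<omega> \<in> reachable n"
    by (subst (asm) prob_Collect_eq_1) auto
  then have "prob {\<omega> \<in> space M. hist n \<omega> \<in> A} = prob {\<omega> \<in> space M. hist n \<omega> \<in> A \<inter> reachable n}"
    by (intro finite_measure_eq_AE) auto
  also have "\<dots> = measure_pmf.prob (hist_pmf n) (A \<inter> reachable n)"
    using finite_reachable by (subst 1) (auto simp: measure_measure_pmf_finite)
  finally show ?thesis by (simp add: measure_Int_set_pmf)
qed

lemma AE_reachable: "AE \<omega> in M. \<forall>n. hist n \<omega> \<in> reachable n"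
proof -
  have "AE \<omega> in M. hist n \<omega> \<in> reachable n" for n
  proof -
    have "measure_pmf.prob (hist_pmf n) (reachable n) = 1"
      by (subst measure_pmf.prob_eq_1) (auto simp: AE_measure_pmf)
    then have "prob {\<omega> \<in> space M. hist n \<omega> \<in> reachable n} = 1" by (simp add: prob_hist_in)
    then show ?thesis by (subst (asm) prob_Collect_eq_1) auto
  qed
  then show ?thesis by (simp add: AE_all_countable)
qed

section \<open>Supermartingale and martingale arguments\<close>

lemma AE_of_prob_le:
  assumes "\<And>i::nat. {\<omega> \<in> space M. P i \<omega>} \<in> events"
    and "\<And>i. prob {\<omega> \<in> space M. P i \<omega>} \<le> c i" and "c \<longlonglongrightarrow> 0"
  shows "AE \<omega> in M. \<exists>i. \<not> P i \<omega>"
proof -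
  let ?B = "{\<omega> \<in> space M. \<forall>i. P i \<omega>}"
  have B: "?B \<in> events" using assms(1) by simp
  \<comment> \<open>The event that all \<open>P i\<close> hold is contained in each of them, so its
    probability is below every \<open>c i\<close>.\<close>
  have "prob ?B \<le> c i" for i
    by (rule order_trans[OF finite_measure_mono assms(2)]) (use assms(1) in auto)
  then have "prob ?B \<le> 0" by (intro LIMSEQ_le_const[OF assms(3)]) auto
  then have "prob ?B = 0" using measure_nonneg[of M ?B] by linarith
  then show ?thesis using prob_eq_0[OF B] by (auto elim: AE_mp)
qed

text \<open>Ville's inequality for a nonnegative supermartingale that is a function of the history,
  started at time \<open>m\<close>.\<close>

lemma maximal_inequality:
  assumes "lev > 0"
    and nonneg: "\<And>n h. n \<ge> m \<Longrightarrow> h \<in> reachable n \<Longrightarrow> 0 \<le> Z h"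
    and super: "\<And>n h. n \<ge> m \<Longrightarrow> h \<in> reachable n \<Longrightarrow> E_step (graph_h h) (\<lambda>S. Z (h @ [S])) \<le> Z h"
  shows "prob {\<omega> \<in> space M. \<exists>n\<ge>m. Z (hist n \<omega>) \<ge> lev} \<le> E_hist m Z / lev"
proof -
  \<comment> \<open>Freezing \<open>Z\<close> at the level from the first passage on keeps its expectation nonincreasing.\<close>
  define hit where "hit h \<longleftrightarrow> (\<exists>k\<in>{m..length h}. Z (take k h) \<ge> lev)" for h
  define Z' where "Z' h = (if hit h then lev else Z h)" for h
  have E: "E_hist n Z' \<le> E_hist m Z" if "n \<ge> m" for n
    using that
  proof (induction n rule: dec_induct)
    case base
    show ?case
    proof (rule E_hist_mono)
      fix h assume "h \<in> reachable m"
      then have "length h = m" by (rule reachable_length)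
      then show "Z' h \<le> Z h" by (auto simp: Z'_def hit_def)
    qed
  next
    case (step n)
    have "E_hist (Suc n) Z' = E_hist n (\<lambda>h. E_step (graph_h h) (\<lambda>S. Z' (h @ [S])))"
      by (rule E_hist_Suc)
    also have "\<dots> \<le> E_hist n Z'"
    proof (rule E_hist_mono)
      fix h assume h: "h \<in> reachable n"
      note G = reachable_model_graph[OF h]
      have len: "length h = n" using h by (rule reachable_length)
      show "E_step (graph_h h) (\<lambda>S. Z' (h @ [S])) \<le> Z' h"
      proof (cases "hit h")
        case True
        then have "hit (h @ [S])" for S unfolding hit_def by force
        then show ?thesis using True by (simp add: Z'_def)
      next
        case False
        have "Z' (h @ [S]) \<le> Z (h @ [S])" for S
        proof (cases "hit (h @ [S])")
          case True
          then obtain k where k: "k \<in> {m..Suc (length h)}" "Z (take k (h @ [S])) \<ge> lev"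
            unfolding hit_def by auto
          \<comment> \<open>The level has not been reached along \<open>h\<close>, so the first
            passage is the new step itself, where \<open>Z\<close> is at least
            \<open>lev\<close>.\<close>
          have "k = Suc (length h)"
          proof (rule ccontr)
            assume "k \<noteq> Suc (length h)"
            then have "k \<in> {m..length h}" using k(1) by auto
            then have "hit h" using k(2) unfolding hit_def by auto
            with False show False by simp
          qed
          then show ?thesis using True k by (simp add: Z'_def)
        qed (simp add: Z'_def)
        then have "E_step (graph_h h) (\<lambda>S. Z' (h @ [S])) \<le> E_step (graph_h h) (\<lambda>S. Z (h @ [S]))"
          by (intro E_step_mono[OF G])
        also have "\<dots> \<le> Z h" using super[OF _ h] step by simp
        finally show ?thesis using False by (simp add: Z'_def)
      qed
    qed
    finally show ?case using step.IH by linarith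
  qed
  have hit_hist: "hit (hist n \<omega>) \<longleftrightarrow> (\<exists>k\<in>{m..n}. Z (hist k \<omega>) \<ge> lev)" for n \<omega>
    unfolding hit_def by (auto simp: take_hist)
  have P: "prob {\<omega> \<in> space M. \<exists>k\<in>{m..n}. Z (hist k \<omega>) \<ge> lev} \<le> E_hist m Z / lev" if "n \<ge> m" for n
  proof -
    have "prob {\<omega> \<in> space M. \<exists>k\<in>{m..n}. Z (hist k \<omega>) \<ge> lev} = measure_pmf.prob (hist_pmf n) {h. hit h}"
      using prob_hist_in[of n "{h. hit h}"] by (simp add: hit_hist)
    also have "\<dots> = E_hist n (indicator {h. hit h})" by simp
    also have "\<dots> \<le> E_hist n (\<lambda>h. Z' h / lev)"
      using nonneg[OF that] assms(1) by (intro E_hist_mono) (auto simp: Z'_def indicator_def)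
    also have "\<dots> = E_hist n Z' / lev" by simp
    also have "\<dots> \<le> E_hist m Z / lev" using E[OF that] assms(1) by (intro divide_right_mono) auto
    finally show ?thesis .
  qed
  \<comment> \<open>The events for finite horizons increase to the event for the infinite
    horizon.\<close>
  define A where "A n = {\<omega> \<in> space M. \<exists>k\<in>{m..n}. Z (hist k \<omega>) \<ge> lev}" for n
  have "range A \<subseteq> sets M" unfolding A_def by auto
  moreover have "incseq A" unfolding A_def incseq_def by force
  ultimately have "(\<lambda>n. prob (A n)) \<longlonglongrightarrow> prob (\<Union>n. A n)"
    by (rule finite_Lim_measure_incseq)
  then have "prob (\<Union>n. A n) \<le> E_hist m Z / lev"
    using P unfolding A_def by (intro LIMSEQ_le_const2) blast+
  also have "(\<Union>n. A n) = {\<omega> \<in> space M. \<exists>n\<ge>m. Z (hist n \<omega>) \<ge> lev}"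
    unfolding A_def by force
  finally show ?thesis .
qed

text \<open>By the maximal inequality at the levels 1, 2, 3, ..., the probability of reaching all of
  them is 0.\<close>

lemma supermartingale_bounded:
  assumes "\<And>n h. n \<ge> m \<Longrightarrow> h \<in> reachable n \<Longrightarrow> 0 \<le> Z h"
    and "\<And>n h. n \<ge> m \<Longrightarrow> h \<in> reachable n \<Longrightarrow> E_step (graph_h h) (\<lambda>S. Z (h @ [S])) \<le> Z h"
  shows "AE \<omega> in M. \<exists>C. \<forall>n\<ge>m. Z (hist n \<omega>) \<le> C"
proof -
  have "AE \<omega> in M. \<exists>i. \<not> (\<exists>n\<ge>m. Z (hist n \<omega>) \<ge> real (Suc i))"
  proof (rule AE_of_prob_le)
    show "prob {\<omega> \<in> space M. \<exists>n\<ge>m. Z (hist n \<omega>) \<ge> real (Suc i)} \<le> E_hist m Z / real (Suc i)" for i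
      by (rule maximal_inequality) (use assms in auto)
    show "(\<lambda>i. E_hist m Z / real (Suc i)) \<longlonglongrightarrow> 0"
      by (rule LIMSEQ_Suc[OF lim_const_over_n])
  qed measurable
  then show ?thesis by eventually_elim (meson not_le_imp_less less_imp_le)
qed

text \<open>Square-integrable martingale convergence. The squared deviation from the value at time m
  becomes a nonnegative supermartingale once the variance \<open>t\<close> still to come is added to
  it. At time m it equals \<open>t m\<close>, which tends to 0, so the maximal inequality yields the
  Cauchy property.\<close>

lemma martingale_summable:
  fixes \<xi> :: "int set list \<Rightarrow> int set \<Rightarrow> real"
  assumes mean: "\<And>n h. h \<in> reachable n \<Longrightarrow> E_step (graph_h h) (\<xi> h) = 0"
    and var: "\<And>n h. h \<in> reachable n \<Longrightarrow> E_step (graph_h h) (\<lambda>S. (\<xi> h S)\<^sup>2) \<le> v n"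
    and v: "summable v" "\<And>n. v n \<ge> 0"
  shows "AE \<omega> in M. summable (\<lambda>k. \<xi> (hist k \<omega>) (I (Suc k) \<omega>))"
proof -
  define X where "X h = (\<Sum>k<length h. \<xi> (take k h) (h ! k))" for h
  have X_snoc: "X (h @ [S]) = X h + \<xi> h S" for h S
    by (simp add: X_def nth_append)
  have X_hist: "X (hist n \<omega>) = (\<Sum>k<n. \<xi> (hist k \<omega>) (I (Suc k) \<omega>))" for n \<omega>
    unfolding X_def by (intro sum.cong) (auto simp: take_hist nth_hist)
  define t where "t n = (\<Sum>k. v (k + n))" for n
  have sv: "summable (\<lambda>k. v (k + n))" for n using v(1) by (simp add: summable_iff_shift)
  have t_nonneg: "t n \<ge> 0" for n
    unfolding t_def by (rule suminf_nonneg[OF sv]) (rule v(2))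
  have t_Suc: "t (Suc n) = t n - v n" for n
    using suminf_split_head[OF sv[of n]] unfolding t_def by simp
  have t0: "t \<longlonglongrightarrow> 0"
    unfolding t_def by (rule suminf_exist_split2[OF v(1)])
  have P: "prob {\<omega> \<in> space M. \<exists>n\<ge>m. \<bar>X (hist n \<omega>) - X (hist m \<omega>)\<bar> \<ge> e} \<le> t m / e\<^sup>2"
    if "e > 0" for e m
  proof -
    define Z where "Z h = (X h - X (take m h))\<^sup>2 + t (length h)" for h
    have "prob {\<omega> \<in> space M. \<exists>n\<ge>m. \<bar>X (hist n \<omega>) - X (hist m \<omega>)\<bar> \<ge> e}
       \<le> prob {\<omega> \<in> space M. \<exists>n\<ge>m. Z (hist n \<omega>) \<ge> e\<^sup>2}"
    proof (rule finite_measure_mono)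
      have "e\<^sup>2 \<le> Z (hist n \<omega>)" if "n \<ge> m" "\<bar>X (hist n \<omega>) - X (hist m \<omega>)\<bar> \<ge> e" for n \<omega>
      proof -
        have "e\<^sup>2 \<le> (X (hist n \<omega>) - X (hist m \<omega>))\<^sup>2"
          using that(2) \<open>e > 0\<close> abs_le_square_iff[of e] by auto
        then show ?thesis using t_nonneg[of n] that(1) by (simp add: Z_def take_hist)
      qed
      then show "{\<omega> \<in> space M. \<exists>n\<ge>m. \<bar>X (hist n \<omega>) - X (hist m \<omega>)\<bar> \<ge> e}
         \<subseteq> {\<omega> \<in> space M. \<exists>n\<ge>m. Z (hist n \<omega>) \<ge> e\<^sup>2}" by blast
    qed measurable
    also have "\<dots> \<le> E_hist m Z / e\<^sup>2"
    proof (rule maximal_inequality)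
      fix n h assume n: "n \<ge> m" and h: "h \<in> reachable n"
      note G = reachable_model_graph[OF h]
      have len: "length h = n" using h by (rule reachable_length)
      show "0 \<le> Z h" unfolding Z_def using t_nonneg by simp
      let ?d = "X h - X (take m h)"
      have "E_step (graph_h h) (\<lambda>S. Z (h @ [S]))
          = E_step (graph_h h) (\<lambda>S. (?d\<^sup>2 + t (Suc n)) + (2 * ?d * \<xi> h S + (\<xi> h S)\<^sup>2))"
        using len n unfolding Z_def
        by (intro E_step_cong[OF G]) (simp add: X_snoc power2_eq_square algebra_simps)
      also have "\<dots> = (?d\<^sup>2 + t (Suc n)) + (2 * ?d * E_step (graph_h h) (\<xi> h) + E_step (graph_h h) (\<lambda>S. (\<xi> h S)\<^sup>2))"
        by (simp only: E_step_add[OF G] E_step_cmult[OF G] E_step_const[OF G])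
      also have "\<dots> \<le> Z h" using mean[OF h] var[OF h] len by (simp add: t_Suc Z_def)
      finally show "E_step (graph_h h) (\<lambda>S. Z (h @ [S])) \<le> Z h" .
    qed (use \<open>e > 0\<close> in auto)
    also have "E_hist m Z \<le> E_hist m (\<lambda>_. t m)"
      by (intro E_hist_mono) (auto simp: Z_def dest: reachable_length)
    then have "E_hist m Z / e\<^sup>2 \<le> t m / e\<^sup>2" by (intro divide_right_mono) auto
    finally show ?thesis .
  qed
  have "AE \<omega> in M. \<forall>i. \<exists>m. \<not> (\<exists>n\<ge>m. \<bar>X (hist n \<omega>) - X (hist m \<omega>)\<bar> \<ge> 1 / real (Suc i))"
    unfolding AE_all_countable
  proof
    fix i
    let ?e = "1 / real (Suc i)"
    show "AE \<omega> in M. \<exists>m. \<not> (\<exists>n\<ge>m. \<bar>X (hist n \<omega>) - X (hist m \<omega>)\<bar> \<ge> ?e)"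
    proof (rule AE_of_prob_le)
      show "prob {\<omega> \<in> space M. \<exists>n\<ge>m. \<bar>X (hist n \<omega>) - X (hist m \<omega>)\<bar> \<ge> ?e} \<le> t m / ?e\<^sup>2" for m
        by (rule P) simp
      show "(\<lambda>m. t m / ?e\<^sup>2) \<longlonglongrightarrow> 0" using tendsto_divide[OF t0 tendsto_const, of "?e\<^sup>2"] by simp
    qed measurable
  qed
  then show ?thesis
  proof eventually_elim
    case (elim \<omega>)
    have "Cauchy (\<lambda>n. X (hist n \<omega>))"
    proof (rule CauchyI')
      fix e :: real assume "e > 0"
      then obtain i where i: "1 / real (Suc i) < e / 2"
        using nat_approx_posE[of "e / 2"] by (auto simp: field_simps)
      from elim obtain m where m: "\<And>n. n \<ge> m \<Longrightarrow> \<bar>X (hist n \<omega>) - X (hist m \<omega>)\<bar> < 1 / real (Suc i)"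
        by (meson not_le)
      have "dist (X (hist a \<omega>)) (X (hist b \<omega>)) < e" if "a \<ge> m" "b > a" for a b
        using m[of a] m[of b] that i unfolding dist_real_def by linarith
      then show "\<exists>M. \<forall>m\<ge>M. \<forall>n>m. dist (X (hist m \<omega>)) (X (hist n \<omega>)) < e" by blast
    qed
    then have "convergent (\<lambda>n. X (hist n \<omega>))" by (rule Cauchy_convergent)
    then show ?case unfolding X_hist by (simp add: summable_iff_convergent)
  qed
qed

text \<open>Truncating by the event \<open>good\<close>, which depends on the past only, turns bounds that hold only along
  good histories into the deterministic bounds needed by the martingale argument.\<close>

lemma increments_summable:
  fixes \<xi> :: "int set list \<Rightarrow> int set \<Rightarrow> real"
  assumes mean: "\<And>n h. n \<ge> m \<Longrightarrow> h \<in> reachable n \<Longrightarrow> good h \<Longrightarrow> \<bar>E_step (graph_h h) (\<xi> h)\<bar> \<le> d n"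
    and var: "\<And>n h. n \<ge> m \<Longrightarrow> h \<in> reachable n \<Longrightarrow> good h \<Longrightarrow> E_step (graph_h h) (\<lambda>S. (\<xi> h S)\<^sup>2) \<le> v n"
    and "summable d" "summable v" "\<And>n. v n \<ge> 0"
  shows "AE \<omega> in M. (\<forall>n\<ge>m. good (hist n \<omega>)) \<longrightarrow> summable (\<lambda>k. \<xi> (hist k \<omega>) (I (Suc k) \<omega>))"
proof -
  define \<mu> where "\<mu> h = E_step (graph_h h) (\<xi> h)" for h
  define \<eta> where "\<eta> h S = (if m \<le> length h \<and> good h then \<xi> h S - \<mu> h else 0)" for h S
  have "AE \<omega> in M. summable (\<lambda>k. \<eta> (hist k \<omega>) (I (Suc k) \<omega>))"
  proof (rule martingale_summable[where v = v])
    fix n h assume h: "h \<in> reachable n"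
    note G = reachable_model_graph[OF h]
    have len: "length h = n" using h by (rule reachable_length)
    have "E_step (graph_h h) (\<eta> h) = 0 \<and> E_step (graph_h h) (\<lambda>S. (\<eta> h S)\<^sup>2) \<le> v n"
    proof (cases "m \<le> n \<and> good h")
      case True
      then have eta: "\<eta> h = (\<lambda>S. \<xi> h S - \<mu> h)" using len by (auto simp: \<eta>_def)
      have 1: "E_step (graph_h h) (\<eta> h) = 0"
        unfolding eta by (simp only: E_step_diff[OF G] E_step_const[OF G]) (simp add: \<mu>_def)
      \<comment> \<open>A conditional variance is at most the conditional second moment.\<close>
      have "E_step (graph_h h) (\<lambda>S. (\<eta> h S)\<^sup>2)
          = E_step (graph_h h) (\<lambda>S. ((\<xi> h S)\<^sup>2 - 2 * \<mu> h * \<xi> h S) + (\<mu> h)\<^sup>2)"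
        unfolding eta by (intro E_step_cong[OF G]) (simp add: power2_eq_square algebra_simps)
      also have "\<dots> = (E_step (graph_h h) (\<lambda>S. (\<xi> h S)\<^sup>2) - 2 * \<mu> h * \<mu> h) + (\<mu> h)\<^sup>2"
        by (simp only: E_step_add[OF G] E_step_diff[OF G] E_step_cmult[OF G] E_step_const[OF G] \<mu>_def)
      also have "\<dots> \<le> E_step (graph_h h) (\<lambda>S. (\<xi> h S)\<^sup>2)" by (simp add: power2_eq_square)
      also have "\<dots> \<le> v n" using True h by (intro var) auto
      finally show ?thesis using 1 by simp
    next
      case False
      then have "\<eta> h = (\<lambda>S. 0)" using len by (auto simp: \<eta>_def)
      then show ?thesis using assms(5) by simp
    qed
    then show "E_step (graph_h h) (\<eta> h) = 0" "E_step (graph_h h) (\<lambda>S. (\<eta> h S)\<^sup>2) \<le> v n" by auto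
  qed (use assms in auto)
  then show ?thesis
    using AE_reachable
  proof eventually_elim
    case (elim \<omega>)
    show ?case
    proof
      \<comment> \<open>From time \<open>m\<close> on, the increments are the centred ones plus
        their conditional means, and both series converge.\<close>
      assume good: "\<forall>n\<ge>m. good (hist n \<omega>)"
      have "summable (\<lambda>k. \<mu> (hist (k + m) \<omega>))"
      proof (rule summable_comparison_test')
        show "summable (\<lambda>k. d (k + m))" using assms(3) by (simp add: summable_iff_shift)
        show "norm (\<mu> (hist (k + m) \<omega>)) \<le> d (k + m)" for k
          using mean[of "k + m" "hist (k + m) \<omega>"] elim(2) good by (simp add: \<mu>_def)
      qed
      moreover have "summable (\<lambda>k. \<eta> (hist (k + m) \<omega>) (I (Suc (k + m)) \<omega>))"
        using elim(1) by (subst summable_iff_shift[where f = "\<lambda>k. \<eta> (hist k \<omega>) (I (Suc k) \<omega>)"])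
      ultimately have "summable (\<lambda>k. \<mu> (hist (k + m) \<omega>) + \<eta> (hist (k + m) \<omega>) (I (Suc (k + m)) \<omega>))"
        by (rule summable_add)
      moreover have "\<mu> (hist (k + m) \<omega>) + \<eta> (hist (k + m) \<omega>) (I (Suc (k + m)) \<omega>)
          = \<xi> (hist (k + m) \<omega>) (I (Suc (k + m)) \<omega>)" for k
        using good by (simp add: \<eta>_def)
      ultimately have "summable (\<lambda>k. \<xi> (hist (k + m) \<omega>) (I (Suc (k + m)) \<omega>))" by simp
      then show "summable (\<lambda>k. \<xi> (hist k \<omega>) (I (Suc k) \<omega>))"
        by (subst (asm) summable_iff_shift[where f = "\<lambda>k. \<xi> (hist k \<omega>) (I (Suc k) \<omega>)"])
    qed
  qed
qed

end

section \<open>Number of vertices and uniform control of the weights\<close>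

text \<open>Bernoulli's inequality in each factor. It allows m-th roots: a bound on the m-th power
  of a weight by \<open>rise (m * \<alpha>)\<close> becomes a bound on the weight by
  \<open>rise \<alpha>\<close>.\<close>

lemma rise_mult_le_power:
  assumes "z \<ge> 0"
  shows "rise (real m * z) n \<le> rise z n ^ m"
  unfolding rise_def prod_power_distrib
proof (intro prod_mono conjI)
  fix k
  have "1 + real m * (z / real (Suc k)) \<le> (1 + z / real (Suc k)) ^ m"
    using assms by (intro Bernoulli_inequality) (simp add: order_trans[of _ 0])
  then show "1 + real m * z / real (Suc k) \<le> (1 + z / real (Suc k)) ^ m" by simp
qed (use assms in auto)

text \<open>\<open>rise (- 1 / 2) n\<close> is the central binomial coefficient 2n choose n divided
  by 4^n, and this is its bound 1 / (2 sqrt n), squared to avoid roots. The induction rests on (2n +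
  1)^2 >= 4 n (n + 1).\<close>

lemma rise_minus_half: "n \<ge> 1 \<Longrightarrow> 1 / (4 * real n) \<le> (rise (- 1 / 2) n)\<^sup>2"
proof (induction n rule: dec_induct)
  case base
  then show ?case by (simp add: rise_def power2_eq_square)
next
  case (step n)
  have "1 + (- 1 / 2) / real (Suc n) = (2 * real n + 1) / (2 * (real n + 1))"
    by (simp add: field_simps)
  then have "(rise (- 1 / 2) (Suc n))\<^sup>2 = (rise (- 1 / 2) n)\<^sup>2 * ((2 * real n + 1) / (2 * (real n + 1)))\<^sup>2"
    by (simp only: rise_Suc power_mult_distrib)
  also have "\<dots> \<ge> 1 / (4 * real n) * ((2 * real n + 1) / (2 * (real n + 1)))\<^sup>2"
    using step.IH by (intro mult_right_mono) auto
  moreover have "1 / (4 * real (Suc n)) \<le> 1 / (4 * real n) * ((2 * real n + 1) / (2 * (real n + 1)))\<^sup>2"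
    using step.hyps by (simp add: divide_simps power2_eq_square) (simp add: algebra_simps)
  ultimately show ?case by linarith
qed

text \<open>The discrete form of x * (x^m)' = m * x^m. That it is exact is the reason to work with
  rising factorials of the weight instead of powers.\<close>

lemma pochhammer_diff:
  fixes a :: real
  shows "a * (pochhammer (a + 1) m - pochhammer a m) = real m * pochhammer a m"
proof (cases m)
  case (Suc k)
  have "pochhammer (a + 1) m = pochhammer (a + 1) k * (a + 1 + real k)"
    "pochhammer a m = a * pochhammer (a + 1) k"
    using Suc by (simp add: pochhammer_Suc, simp add: pochhammer_rec)
  then show ?thesis using Suc by (simp add: algebra_simps)
qed simp

lemma power_le_pochhammer:
  fixes a :: real
  assumes "0 \<le> x" "x \<le> a"
  shows "x ^ m \<le> pochhammer a m"
proof (induction m)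
  case (Suc m)
  have "x ^ m * x \<le> pochhammer a m * (a + real m)"
    using Suc assms by (intro mult_mono) (auto intro: order_trans[of 0 "x ^ m"])
  then show ?case by (simp add: pochhammer_Suc mult.commute)
qed simp

context interaction_params
begin

lemma card_verts_interact:
  assumes "model_graph N n G" "admissible N G S"
  shows "card (verts G \<union> S) = card (verts G) \<or> card (verts G \<union> S) = Suc (card (verts G))"
proof -
  consider "verts G \<union> S = verts G" | "verts G \<union> S = insert (new_label G) (verts G)"
    using assms(2) unfolding admissible_def by auto
  then show ?thesis
    using finite_verts[OF N_ge assms(1)] new_label_notin[OF N_ge assms(1)] by cases auto
qed

end

context nondegenerate_model
begin

abbreviation vcount :: "int set list \<Rightarrow> nat" where
  "vcount h \<equiv> card (verts (graph_h h))"

abbreviation wt :: "int \<Rightarrow> int set list \<Rightarrow> nat" where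
  "wt j h \<equiv> weight (graph_h h) {j}"

abbreviation dg :: "int \<Rightarrow> int set list \<Rightarrow> nat" where
  "dg j h \<equiv> degree_in (graph_h h) j"

text \<open>The vertex count grows like p n; half of that slope is a deterministic bound that holds
  from some random time on.\<close>

definition dense :: "int set list \<Rightarrow> bool" where
  "dense h \<longleftrightarrow> real (vcount h) \<ge> p / 2 * real (Suc (length h))"

text \<open>A law of large numbers: the centred increments divided by the time are martingale
  differences with summable variances, and Kronecker's lemma applies.\<close>

lemma AE_vertex_density:
  "AE \<omega> in M. (\<lambda>n. (real (vcount (hist n \<omega>)) - real N - p * real n) / real (Suc n)) \<longlonglongrightarrow> 0"
proof -
  define \<xi> where "\<xi> h S = (real (card (verts (graph_h h) \<union> S)) - real (vcount h) - p) / real (Suc (length h))"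
    for h S
  have "AE \<omega> in M. (\<forall>n\<ge>(0::nat). True) \<longrightarrow> summable (\<lambda>k. \<xi> (hist k \<omega>) (I (Suc k) \<omega>))"
  proof (rule increments_summable[where m = 0 and good = "\<lambda>_. True" and \<xi> = \<xi> and d = "\<lambda>_. 0" and v = "\<lambda>n. 1 / real (Suc n) ^ 2"])
    show "summable (\<lambda>n. 1 / real (Suc n) ^ 2)"
      using inverse_power_summable[of 2, where 'a=real]
      by (subst summable_Suc_iff) (simp add: inverse_eq_divide)
    fix n h assume h: "h \<in> reachable n"
    note G = reachable_model_graph[OF h]
    have len: "length h = n" using h by (rule reachable_length)
    have "E_step (graph_h h) (\<xi> h) = 0"
      unfolding \<xi>_def E_step_divide[OF G]
      by (subst E_step_diff[OF G]) (simp add: E_step_new_vertex[OF G])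
    then show "\<bar>E_step (graph_h h) (\<xi> h)\<bar> \<le> 0" by simp
    have "E_step (graph_h h) (\<lambda>S. (\<xi> h S)\<^sup>2) \<le> E_step (graph_h h) (\<lambda>S. 1 / real (Suc n) ^ 2)"
    proof (rule E_step_mono[OF G])
      fix S assume "admissible N (graph_h h) S"
      from card_verts_interact[OF G this]
      have "\<bar>real (card (verts (graph_h h) \<union> S)) - real (vcount h) - p\<bar> \<le> 1"
        using p_pos p_le by auto
      then have "(real (card (verts (graph_h h) \<union> S)) - real (vcount h) - p)\<^sup>2 \<le> 1"
        by (simp add: abs_square_le_1)
      then show "(\<xi> h S)\<^sup>2 \<le> 1 / real (Suc n) ^ 2"
        unfolding \<xi>_def power_divide len by (intro divide_right_mono) auto
    qed
    then show "E_step (graph_h h) (\<lambda>S. (\<xi> h S)\<^sup>2) \<le> 1 / real (Suc n) ^ 2"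
      by simp
  qed auto
  then show ?thesis
  proof eventually_elim
    case (elim \<omega>)
    define x where "x k = real (vcount (hist (Suc k) \<omega>)) - real (vcount (hist k \<omega>)) - p" for k
    have "summable (\<lambda>k. x k / real (Suc k))"
      using elim unfolding \<xi>_def x_def by (simp add: hist_Suc)
    then have "(\<lambda>n. (\<Sum>k<n. x k) / real (Suc n)) \<longlonglongrightarrow> 0"
    proof (rule kronecker)
      show "filterlim (\<lambda>k. real (Suc k)) at_top sequentially" by real_asymp
    qed (auto simp: incseq_def)
    moreover have "(\<Sum>k<n. x k) = real (vcount (hist n \<omega>)) - real N - p * real n" for n
    proof -
      have "vcount (hist 0 \<omega>) = N" by (simp add: initial_graph_def Let_def)
      then show ?thesis by (induction n) (simp_all add: x_def algebra_simps)
    qed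
    ultimately show ?case by simp
  qed
qed

lemma AE_eventually_dense:
  "AE \<omega> in M. \<exists>m. \<forall>n\<ge>m. dense (hist n \<omega>)"
  using AE_vertex_density
proof eventually_elim
  case (elim \<omega>)
  have "\<forall>\<^sub>F n in sequentially. (real (vcount (hist n \<omega>)) - real N - p * real n) / real (Suc n) > - p / 2"
    by (rule order_tendstoD(1)[OF elim]) (use p_pos in simp)
  then have "\<forall>\<^sub>F n in sequentially. dense (hist n \<omega>)"
  proof eventually_elim
    case (elim n)
    have "- p / 2 * real (Suc n) < real (vcount (hist n \<omega>)) - real N - p * real n"
      using elim by (simp add: pos_less_divide_eq)
    moreover have "- p / 2 * real (Suc n) = p / 2 * real (Suc n) - p * real n - p"
      by (simp add: field_simps)
    \<comment> \<open>The N initial vertices make up for the difference between p n and p (n +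
      1).\<close>
    moreover have "p \<le> real N" using p_le N_ge by simp
    ultimately show ?case unfolding dense_def length_hist by linarith
  qed
  then show ?case by (simp add: eventually_sequentially)
qed

lemma dense_rate:
  assumes "dense h" "length h = n"
  shows "uniform_rate / real (vcount h) \<le> 2 * real N / p / real (Suc n)"
proof -
  have pos: "p / 2 * real (Suc n) > 0" using p_pos by simp
  have le: "p / 2 * real (Suc n) \<le> real (vcount h)" using assms unfolding dense_def by simp
  have "uniform_rate / real (vcount h) \<le> real N / (p / 2 * real (Suc n))"
    using le pos uniform_rate_bounds by (intro frac_le) auto
  then show ?thesis using p_pos by (simp add: field_simps)
qed

lemma wt_snoc: "wt j (h @ [S]) = wt j h + of_bool (j \<in> S)"
  by simp

lemma E_step_wt:
  assumes "h \<in> reachable n" "j \<in> verts (graph_h h)"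
  shows "E_step (graph_h h) (\<lambda>S. f (wt j (h @ [S])))
    = f (wt j h) + (\<alpha> * real (wt j h) / real (Suc n) + uniform_rate / real (vcount h))
        * (f (wt j h + 1) - f (wt j h))"
proof -
  note G = reachable_model_graph[OF assms(1)]
  have "E_step (graph_h h) (\<lambda>S. f (wt j (h @ [S])))
      = E_step (graph_h h) (\<lambda>S. f (wt j h) + (f (wt j h + 1) - f (wt j h)) * of_bool (j \<in> S))"
    by (intro E_step_cong[OF G]) simp
  also have "\<dots> = f (wt j h) + (f (wt j h + 1) - f (wt j h))
      * (\<alpha> * real (wt j h) / real (Suc n) + uniform_rate / real (vcount h))"
    by (simp only: E_step_add[OF G] E_step_cmult[OF G] E_step_const[OF G] E_step_member[OF G assms(2)])
  finally show ?thesis by (simp add: mult.commute)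
qed

section \<open>Rising factorial moments of the weights\<close>

context
  assumes alpha_pos: "\<alpha> > 0"
begin

text \<open>Chosen so that \<open>\<alpha> * shift / (n + 1)\<close> is exactly the bound of
  \<open>dense_rate\<close> on the probability of a uniform hit.\<close>

definition shift :: real where
  "shift = 2 * real N / p / \<alpha>"

definition psi :: "nat \<Rightarrow> nat \<Rightarrow> real" where
  "psi m w = pochhammer (real w + shift) m"

lemma shift_pos: "shift > 0"
  unfolding shift_def using N_ge p_pos alpha_pos by simp

lemma psi_pos: "psi m w > 0"
  unfolding psi_def using shift_pos by (intro pochhammer_pos) simp

text \<open>The shift absorbs the contribution of the uniform choices to the interaction probability,
  so that the rising factorial grows exactly like the product \<open>rise\<close>.\<close>

lemma E_step_psi:
  assumes h: "h \<in> reachable n" and j: "j \<in> verts (graph_h h)" and "dense h"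
  shows "E_step (graph_h h) (\<lambda>S. psi m (wt j (h @ [S])))
    \<le> (1 + real m * \<alpha> / real (Suc n)) * psi m (wt j h)"
proof -
  have len: "length h = n" using h by (rule reachable_length)
  let ?a = "real (wt j h) + shift"
  have "uniform_rate / real (vcount h) \<le> \<alpha> * shift / real (Suc n)"
    using dense_rate[OF assms(3) len] alpha_pos unfolding shift_def by simp
  then have P: "\<alpha> * real (wt j h) / real (Suc n) + uniform_rate / real (vcount h) \<le> \<alpha> / real (Suc n) * ?a"
    by (simp add: distrib_left add_divide_distrib)
  have a: "?a > 0" using shift_pos by simp
  have "psi m (wt j h + 1) = pochhammer (?a + 1) m"
    unfolding psi_def by (simp add: algebra_simps)
  then have diff: "?a * (psi m (wt j h + 1) - psi m (wt j h)) = real m * psi m (wt j h)"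
    using pochhammer_diff[of ?a m] unfolding psi_def by simp
  then have "psi m (wt j h + 1) - psi m (wt j h) \<ge> 0"
    using a psi_pos[of m "wt j h"] by (metis mult_nonneg_nonneg of_nat_0_le_iff less_imp_le zero_le_mult_iff not_le)
  then have "E_step (graph_h h) (\<lambda>S. psi m (wt j (h @ [S])))
    \<le> psi m (wt j h) + \<alpha> / real (Suc n) * ?a * (psi m (wt j h + 1) - psi m (wt j h))"
    unfolding E_step_wt[OF h j, of "psi m"] using P by (intro add_left_mono mult_right_mono)
  also have "\<dots> = psi m (wt j h) + \<alpha> / real (Suc n) * (real m * psi m (wt j h))"
    by (simp only: diff mult.assoc)
  finally show ?thesis by (simp add: algebra_simps)
qed

text \<open>Unlike \<open>dense\<close>, this cannot be regained once it is lost. A potential set to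
  0 at the first failure therefore stays 0, which keeps the supermartingale property.\<close>

definition ok :: "nat \<Rightarrow> int set list \<Rightarrow> bool" where
  "ok m0 h \<longleftrightarrow> (\<forall>k\<in>{m0..length h}. dense (take k h))"

definition tail_sum :: "nat \<Rightarrow> int \<Rightarrow> int set list \<Rightarrow> real" where
  "tail_sum m J h = (\<Sum>j\<in>verts (graph_h h) \<inter> {J..}. psi m (wt j h))"

text \<open>\<open>birth m n\<close> pays in advance for the contributions of the vertices born after time \<open>n\<close>, which makes
  \<open>potential\<close> below a supermartingale.\<close>

definition birth :: "nat \<Rightarrow> nat \<Rightarrow> real" where
  "birth m n = psi m 1 * (\<Sum>k. 1 / rise (real m * \<alpha>) (Suc (k + n)))"

definition potential :: "nat \<Rightarrow> nat \<Rightarrow> int \<Rightarrow> int set list \<Rightarrow> real" where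
  "potential m m0 J h =
     (if ok m0 h then tail_sum m J h / rise (real m * \<alpha>) (length h) + birth m (length h) else 0)"

context
  fixes m :: nat
  assumes m: "real m * \<alpha> \<ge> 2"
begin

lemma rise_m_pos: "rise (real m * \<alpha>) n > 0"
  using m by (intro rise_pos) simp

lemma birth_Suc: "birth m n = psi m 1 / rise (real m * \<alpha>) (Suc n) + birth m (Suc n)"
proof -
  have "summable (\<lambda>k. 1 / rise (real m * \<alpha>) (Suc (k + n)))"
    using summable_inverse_rise[OF m] by (subst summable_iff_shift)
  from suminf_split_head[OF this]
  have "(\<Sum>k. 1 / rise (real m * \<alpha>) (Suc (k + n)))
      = 1 / rise (real m * \<alpha>) (Suc n) + (\<Sum>k. 1 / rise (real m * \<alpha>) (Suc (k + Suc n)))"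
    by simp
  then show ?thesis unfolding birth_def by (simp only: distrib_left) simp
qed

lemma birth_tendsto_0: "birth m \<longlonglongrightarrow> 0"
proof -
  have "(\<lambda>n. \<Sum>k. 1 / rise (real m * \<alpha>) (Suc (k + n))) \<longlonglongrightarrow> 0"
    by (rule suminf_exist_split2[OF summable_inverse_rise[OF m]])
  from tendsto_mult_left[OF this, of "psi m 1"] show ?thesis
    unfolding birth_def by simp
qed

lemma birth_nonneg: "birth m n \<ge> 0"
proof -
  have "summable (\<lambda>k. 1 / rise (real m * \<alpha>) (Suc (k + n)))"
    using summable_inverse_rise[OF m] by (subst summable_iff_shift)
  then show ?thesis unfolding birth_def
    using psi_pos[of m 1] rise_m_pos by (intro mult_nonneg_nonneg suminf_nonneg) (auto intro: less_imp_le)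
qed

lemma tail_sum_nonneg: "tail_sum m J h \<ge> 0"
  unfolding tail_sum_def by (intro sum_nonneg) (auto intro: less_imp_le psi_pos)

lemma potential_nonneg: "potential m m0 J h \<ge> 0"
  unfolding potential_def using tail_sum_nonneg birth_nonneg rise_m_pos by (simp add: less_imp_le)

text \<open>At most one vertex is born in a step, and it starts with weight 1, whence the additional
  \<open>psi m 1\<close>.\<close>

lemma E_step_tail_sum:
  assumes h: "h \<in> reachable n" and "dense h"
  shows "E_step (graph_h h) (\<lambda>S. tail_sum m J (h @ [S]))
    \<le> (1 + real m * \<alpha> / real (Suc n)) * tail_sum m J h + psi m 1"
proof -
  note G = reachable_model_graph[OF h]
  let ?G = "graph_h h" and ?v = "new_label (graph_h h)"
  let ?A = "verts ?G \<inter> {J..}"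
  have fin: "finite ?A" using finite_verts[OF N_ge G] by simp
  have "E_step ?G (\<lambda>S. tail_sum m J (h @ [S]))
     \<le> E_step ?G (\<lambda>S. (\<Sum>j\<in>?A. psi m (wt j (h @ [S]))) + psi m 1)"
  proof (rule E_step_mono[OF G])
    fix S assume S: "admissible N ?G S"
    consider "verts ?G \<union> S = verts ?G" | "verts ?G \<union> S = insert ?v (verts ?G)" "?v \<in> S"
      using S unfolding admissible_def by auto
    then show "tail_sum m J (h @ [S]) \<le> (\<Sum>j\<in>?A. psi m (wt j (h @ [S]))) + psi m 1"
    proof cases
      case 1
      then show ?thesis using psi_pos[of m 1] unfolding tail_sum_def by simp
    next
      case 2
      have "tail_sum m J (h @ [S]) \<le> (\<Sum>j\<in>insert ?v ?A. psi m (wt j (h @ [S])))"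
        unfolding tail_sum_def using fin 2 psi_pos
        by (intro sum_mono2) (auto intro: less_imp_le)
      also have "\<dots> = psi m (wt ?v (h @ [S])) + (\<Sum>j\<in>?A. psi m (wt j (h @ [S])))"
        using fin new_label_notin[OF N_ge G] by (intro sum.insert) auto
      also have "wt ?v (h @ [S]) = 1"
        using 2 weight_notin_verts[OF N_ge G new_label_notin[OF N_ge G]] by simp
      finally show ?thesis by simp
    qed
  qed
  also have "\<dots> = (\<Sum>j\<in>?A. E_step ?G (\<lambda>S. psi m (wt j (h @ [S])))) + psi m 1"
    by (simp only: E_step_add[OF G] E_step_sum[OF G] E_step_const[OF G])
  also have "\<dots> \<le> (\<Sum>j\<in>?A. (1 + real m * \<alpha> / real (Suc n)) * psi m (wt j h)) + psi m 1"
    using E_step_psi[OF h _ assms(2), of _ m] by (intro add_right_mono sum_mono) blast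
  finally show ?thesis by (simp add: tail_sum_def sum_distrib_left)
qed

lemma E_step_potential:
  assumes h: "h \<in> reachable n" and n: "n \<ge> m0"
  shows "E_step (graph_h h) (\<lambda>S. potential m m0 J (h @ [S])) \<le> potential m m0 J h"
proof (cases "ok m0 h")
  case False
  then have "\<not> ok m0 (h @ [S])" for S
    unfolding ok_def by force
  then show ?thesis using False by (simp add: potential_def)
next
  case True
  note G = reachable_model_graph[OF h]
  have len: "length h = n" using h by (rule reachable_length)
  have dense: "dense h" using bspec[OF True[unfolded ok_def], of n] n len by simp
  let ?r = "rise (real m * \<alpha>)"
  \<comment> \<open>If the density fails at the next step, the potential drops to 0, which is below
    the bound.\<close>
  have "E_step (graph_h h) (\<lambda>S. potential m m0 J (h @ [S]))
     \<le> E_step (graph_h h) (\<lambda>S. tail_sum m J (h @ [S]) / ?r (Suc n) + birth m (Suc n))"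
    using tail_sum_nonneg birth_nonneg rise_m_pos len
    by (intro E_step_mono[OF G]) (auto simp: potential_def less_imp_le)
  also have "\<dots> = E_step (graph_h h) (\<lambda>S. tail_sum m J (h @ [S])) / ?r (Suc n) + birth m (Suc n)"
    by (simp only: E_step_add[OF G] E_step_divide[OF G] E_step_const[OF G])
  also have "\<dots> \<le> ((1 + real m * \<alpha> / real (Suc n)) * tail_sum m J h + psi m 1) / ?r (Suc n) + birth m (Suc n)"
    using E_step_tail_sum[OF h dense] rise_m_pos[of "Suc n"]
    by (intro add_right_mono divide_right_mono) auto
  \<comment> \<open>The factor of the conditional mean is the last factor of \<open>rise\<close>,
    and the contribution of a birth is the first term of the series
    \<open>birth m n\<close>.\<close>
  also have "\<dots> = tail_sum m J h / ?r n + birth m n"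
  proof -
    have "1 + real m * \<alpha> / real (Suc n) > 0" using m by (intro add_pos_nonneg divide_nonneg_nonneg) auto
    then have "(1 + real m * \<alpha> / real (Suc n)) * tail_sum m J h / ?r (Suc n) = tail_sum m J h / ?r n"
      by (simp add: rise_Suc del: of_nat_Suc)
    then show ?thesis by (simp add: birth_Suc[of n] add_divide_distrib)
  qed
  finally show ?thesis using True len by (simp add: potential_def)
qed

lemma wt_power_le_potential:
  assumes "h \<in> reachable n" "ok m0 h" "j \<ge> J"
  shows "real (wt j h) ^ m \<le> potential m m0 J h * rise (real m * \<alpha>) n"
proof (cases "j \<in> verts (graph_h h)")
  case True
  note G = reachable_model_graph[OF assms(1)]
  have len: "length h = n" using assms(1) by (rule reachable_length)
  have "real (wt j h) ^ m \<le> psi m (wt j h)"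
    unfolding psi_def using shift_pos by (intro power_le_pochhammer) auto
  also have "\<dots> \<le> tail_sum m J h"
    unfolding tail_sum_def
    by (rule member_le_sum) (use True assms finite_verts[OF N_ge G] psi_pos in \<open>auto intro: less_imp_le\<close>)
  also have "\<dots> \<le> (tail_sum m J h / rise (real m * \<alpha>) n + birth m n) * rise (real m * \<alpha>) n"
    using birth_nonneg[of n] rise_m_pos[of n] by (simp add: distrib_right)
  finally show ?thesis using assms len by (simp add: potential_def)
next
  case False
  \<comment> \<open>An absent vertex has weight 0, and its power is 0 only for a positive
    exponent.\<close>
  have "m > 0" using m by (cases m) auto
  with False show ?thesis
    using weight_notin_verts[OF N_ge reachable_model_graph[OF assms(1)] False]
      mult_nonneg_nonneg[OF potential_nonneg[of m0 J h] less_imp_le[OF rise_m_pos[of n]]]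
    by (simp add: zero_power)
qed

lemma ok_hist: "\<forall>n\<ge>m0. dense (hist n \<omega>) \<Longrightarrow> ok m0 (hist n \<omega>)"
  unfolding ok_def by (simp add: take_hist)

text \<open>The m-th root of the bound on the potential. The time \<open>m0\<close> from which the
  density holds is random, so the potentials for all \<open>m0\<close> are treated at once. The
  bound is what later makes the second moments of a single vertex summable.\<close>

lemma AE_wt_bounded:
  "AE \<omega> in M. \<exists>L::nat. \<forall>n j. j \<ge> 1 - int N \<longrightarrow> real (wt j (hist n \<omega>)) \<le> real L * rise \<alpha> n"
proof -
  have "AE \<omega> in M. \<forall>m0. \<exists>C. \<forall>n\<ge>m0. potential m m0 (1 - int N) (hist n \<omega>) \<le> C"
    unfolding AE_all_countable
    by (intro allI supermartingale_bounded potential_nonneg E_step_potential)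
  then show ?thesis
    using AE_eventually_dense AE_reachable
  proof eventually_elim
    case (elim \<omega>)
    then obtain m0 where m0: "\<forall>n\<ge>m0. dense (hist n \<omega>)" by blast
    from elim obtain C where C: "\<And>n. n \<ge> m0 \<Longrightarrow> potential m m0 (1 - int N) (hist n \<omega>) \<le> C" by blast
    \<comment> \<open>\<open>L \<ge> 1\<close> gives \<open>L \<le> L ^ m\<close>;
      \<open>L \<ge> Suc m0\<close> covers the times before \<open>m0\<close>, where the weight is
      at most n + 1.\<close>
    obtain L :: nat where L: "real L \<ge> max (max 1 C) (real (Suc m0))"
      using real_arch_simple by blast
    have m_pos: "m > 0" using m by (cases m) auto
    have "real (wt j (hist n \<omega>)) \<le> real L * rise \<alpha> n" if j: "j \<ge> 1 - int N" for n j
    proof (cases "n \<ge> m0")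
      case True
      have "real (wt j (hist n \<omega>)) ^ m \<le> potential m m0 (1 - int N) (hist n \<omega>) * rise (real m * \<alpha>) n"
        using elim j by (intro wt_power_le_potential ok_hist m0) auto
      also have "\<dots> \<le> real L ^ m * rise \<alpha> n ^ m"
      proof (intro mult_mono)
        have "C \<le> real L ^ 1" using L by simp
        also have "\<dots> \<le> real L ^ m" using L m_pos by (intro power_increasing) auto
        finally show "potential m m0 (1 - int N) (hist n \<omega>) \<le> real L ^ m"
          using C[OF True] by linarith
      qed (use rise_mult_le_power alpha_pos rise_m_pos in \<open>auto intro: less_imp_le\<close>)
      finally have "real (wt j (hist n \<omega>)) ^ m \<le> (real L * rise \<alpha> n) ^ m" by (simp add: power_mult_distrib)
      then show ?thesis
        using rise_ge_1[of \<alpha> n] alpha_pos m_pos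
        by (subst (asm) power_mono_iff) auto
    next
      case False
      have "real (wt j (hist n \<omega>)) \<le> real (Suc n)"
        using weight_vertex_le[OF N_ge reachable_model_graph] elim by (metis of_nat_le_iff)
      also have "\<dots> \<le> real L * 1" using False L by auto
      also have "\<dots> \<le> real L * rise \<alpha> n"
        using rise_ge_1[of \<alpha> n] alpha_pos by (intro mult_left_mono) auto
      finally show ?thesis .
    qed
    then show ?case by blast
  qed
qed

text \<open>The potential of the labels above m0 + k is started at time m0 + k, when none of them
  exists. Its initial value is then at most \<open>birth m (m0 + k)\<close>, which tends to 0, and
  the maximal inequality bounds all these vertices at all later times.\<close>

lemma AE_wt_tail:
  "AE \<omega> in M. \<forall>\<epsilon>>0. \<exists>J. \<forall>n\<ge>J. \<forall>j\<ge>int J. real (wt j (hist n \<omega>)) \<le> \<epsilon> * rise \<alpha> n"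
proof -
  have "AE \<omega> in M. \<forall>m0 i. \<exists>k. \<not> (\<exists>n\<ge>m0 + k.
      potential m m0 (int (m0 + k) + 1) (hist n \<omega>) \<ge> 1 / real (Suc i))"
    unfolding AE_all_countable
  proof (intro allI)
    fix m0 i
    show "AE \<omega> in M. \<exists>k. \<not> (\<exists>n\<ge>m0 + k.
      potential m m0 (int (m0 + k) + 1) (hist n \<omega>) \<ge> 1 / real (Suc i))"
    proof (rule AE_of_prob_le)
      fix k
      have "prob {\<omega> \<in> space M. \<exists>n\<ge>m0 + k. potential m m0 (int (m0 + k) + 1) (hist n \<omega>) \<ge> 1 / real (Suc i)}
        \<le> E_hist (m0 + k) (potential m m0 (int (m0 + k) + 1)) / (1 / real (Suc i))"
        by (rule maximal_inequality) (auto intro: potential_nonneg E_step_potential)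
      also have "E_hist (m0 + k) (potential m m0 (int (m0 + k) + 1)) \<le> E_hist (m0 + k) (\<lambda>_. birth m (m0 + k))"
      proof (rule E_hist_mono)
        fix h assume h: "h \<in> reachable (m0 + k)"
        note G = reachable_model_graph[OF h]
        \<comment> \<open>After n steps there are at most N + n vertices, so that no label exceeds
          n.\<close>
        have "verts (graph_h h) \<inter> {int (m0 + k) + 1..} = {}"
          using card_verts_le[OF N_ge G] by (subst verts_eq[OF N_ge G]) auto
        then have "tail_sum m (int (m0 + k) + 1) h = 0" by (simp add: tail_sum_def)
        then show "potential m m0 (int (m0 + k) + 1) h \<le> birth m (m0 + k)"
          using birth_nonneg reachable_length[OF h] by (simp add: potential_def)
      qed
      finally show "prob {\<omega> \<in> space M. \<exists>n\<ge>m0 + k. potential m m0 (int (m0 + k) + 1) (hist n \<omega>) \<ge> 1 / real (Suc i)}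
        \<le> real (Suc i) * birth m (k + m0)"
        by (simp add: mult_left_mono add.commute mult.commute)
    next
      show "(\<lambda>k. real (Suc i) * birth m (k + m0)) \<longlonglongrightarrow> 0"
        using tendsto_mult_left[OF LIMSEQ_ignore_initial_segment[OF birth_tendsto_0, of m0], of "real (Suc i)"]
        by simp
    qed measurable
  qed
  then show ?thesis
    using AE_eventually_dense AE_reachable
  proof eventually_elim
    case (elim \<omega>)
    then obtain m0 where m0: "\<forall>n\<ge>m0. dense (hist n \<omega>)" by blast
    have m_pos: "m > 0" using m by (cases m) auto
    show ?case
    proof (intro allI impI)
      fix \<epsilon> :: real assume \<epsilon>: "\<epsilon> > 0"
      obtain i where i: "1 / real (Suc i) < \<epsilon> ^ m"
        using nat_approx_posE[of "\<epsilon> ^ m"] \<epsilon> by auto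
      from elim(1) obtain k where k: "\<And>n. n \<ge> m0 + k \<Longrightarrow>
          potential m m0 (int (m0 + k) + 1) (hist n \<omega>) < 1 / real (Suc i)"
        by (meson not_le)
      have "real (wt j (hist n \<omega>)) \<le> \<epsilon> * rise \<alpha> n" if "n \<ge> Suc (m0 + k)" "j \<ge> int (Suc (m0 + k))" for n j
      proof -
        have "real (wt j (hist n \<omega>)) ^ m \<le> potential m m0 (int (m0 + k) + 1) (hist n \<omega>) * rise (real m * \<alpha>) n"
          using elim that by (intro wt_power_le_potential ok_hist m0) auto
        also have "\<dots> \<le> \<epsilon> ^ m * rise \<alpha> n ^ m"
          using k[of n] that i rise_mult_le_power[of \<alpha> m n] alpha_pos rise_m_pos[of n] \<epsilon>
          by (intro mult_mono) auto
        finally have "real (wt j (hist n \<omega>)) ^ m \<le> (\<epsilon> * rise \<alpha> n) ^ m" by (simp add: power_mult_distrib)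
        then show ?thesis
          using rise_ge_1[of \<alpha> n] alpha_pos m_pos \<epsilon>
          by (subst (asm) power_mono_iff) auto
      qed
      then show "\<exists>J. \<forall>n\<ge>J. \<forall>j\<ge>int J. real (wt j (hist n \<omega>)) \<le> \<epsilon> * rise \<alpha> n" by blast
    qed
  qed
qed

end
end
end

section \<open>Individual vertices\<close>

context nondegenerate_model
begin

context
  assumes alpha_pos: "\<alpha> > 0"
begin

text \<open>Depends on the history only, with a deterministic constant: it is the event used for
  truncation in \<open>increments_summable\<close>. A natural number \<open>L\<close> keeps the
  number of null sets countable.\<close>

definition tame :: "int \<Rightarrow> nat \<Rightarrow> int set list \<Rightarrow> bool" where
  "tame j L h \<longleftrightarrow> dense h \<and> j \<in> verts (graph_h h) \<and> real (wt j h) \<le> real L * rise \<alpha> (length h)"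

lemma AE_eventually_tame:
  "AE \<omega> in M. \<forall>j\<ge>1 - int N. \<exists>m L. \<forall>n\<ge>m. tame j L (hist n \<omega>)"
proof -
  obtain m :: nat where "real m \<ge> 2 / \<alpha>" using real_arch_simple by blast
  then have "real m * \<alpha> \<ge> 2" using alpha_pos by (simp add: field_simps)
  from AE_wt_bounded[OF alpha_pos this] AE_eventually_dense AE_reachable show ?thesis
  proof eventually_elim
    case (elim \<omega>)
    then obtain m L where m: "\<forall>n\<ge>m. dense (hist n \<omega>)"
      and L: "\<And>n j. j \<ge> 1 - int N \<Longrightarrow> real (wt j (hist n \<omega>)) \<le> real L * rise \<alpha> n" by blast
    show ?case
    proof (intro allI impI)
      fix j assume j: "j \<ge> 1 - int N"
      \<comment> \<open>The labels fill an interval up to V - N, so \<open>j\<close> is present as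
        soon as V >= j + N; the density guarantees this from time \<open>k\<close> on.\<close>
      obtain k :: nat where k: "real k \<ge> 2 * real_of_int (j + int N) / p" using real_arch_simple by blast
      have "tame j L (hist n \<omega>)" if n: "n \<ge> max m k" for n
      proof -
        have d: "dense (hist n \<omega>)" using m n by auto
        have "real_of_int (j + int N) \<le> p / 2 * real k" using k p_pos by (simp add: field_simps)
        also have "\<dots> \<le> p / 2 * real (Suc n)" using n p_pos by (intro mult_left_mono) auto
        also have "\<dots> \<le> real (vcount (hist n \<omega>))" using d unfolding dense_def by simp
        finally have "real_of_int (j + int N) \<le> real_of_int (int (vcount (hist n \<omega>)))" by simp
        then have "j + int N \<le> int (vcount (hist n \<omega>))" by (simp only: of_int_le_iff)
        moreover note G = reachable_model_graph[OF elim(3)[rule_format, of n]]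
        ultimately have "j \<in> verts (graph_h (hist n \<omega>))"
          using j by (subst verts_eq[OF N_ge G]) auto
        with d L[OF j] show ?thesis by (simp add: tame_def)
      qed
      then show "\<exists>m L. \<forall>n\<ge>m. tame j L (hist n \<omega>)" by blast
    qed
  qed
qed

section \<open>One-step bounds for a tame history\<close>

context
  fixes n :: nat and h :: "int set list" and j :: int and L :: nat
  assumes h: "h \<in> reachable n" and tame: "tame j L h"
begin

lemma tame_rate: "uniform_rate / real (vcount h) \<le> 2 * real N / p / real (Suc n)"
  using dense_rate reachable_length[OF h] tame unfolding tame_def by blast

lemma tame_prob:
  "\<alpha> * real (wt j h) / real (Suc n) \<le> 1"
  "\<alpha> * real (wt j h) / real (Suc n) \<le> real L * rise \<alpha> (Suc n) / real (Suc n)"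
proof -
  have "\<alpha> * real (wt j h) \<le> 1 * real (Suc n)"
    using alpha_le_1 weight_vertex_le[OF N_ge reachable_model_graph[OF h], of j] alpha_pos
    by (intro mult_mono) auto
  then show "\<alpha> * real (wt j h) / real (Suc n) \<le> 1" by simp
  have "\<alpha> * real (wt j h) \<le> 1 * (real L * rise \<alpha> n)"
    using alpha_le_1 tame reachable_length[OF h] alpha_pos unfolding tame_def
    by (intro mult_mono) auto
  also have "\<dots> \<le> real L * rise \<alpha> (Suc n)"
    using incseq_SucD[OF incseq_rise[of \<alpha>], of n] alpha_pos by (simp add: mult_left_mono)
  finally show "\<alpha> * real (wt j h) / real (Suc n) \<le> real L * rise \<alpha> (Suc n) / real (Suc n)"
    by (intro divide_right_mono) auto
qed

text \<open>The numerator is O(\<open>rise \<alpha> (Suc n)\<close> / (n + 1)) because the weight is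
  at most \<open>L * rise \<alpha> n\<close>; division by the square leaves the summable sequence of
  \<open>summable_inverse_mult_rise\<close>.\<close>

lemma tame_second_moment:
  "(2 * (\<alpha> * real (wt j h) / real (Suc n)) + uniform_rate / real (vcount h)) / (rise \<alpha> (Suc n))\<^sup>2
    \<le> (2 * real L + 2 * real N / p) * (1 / (real (Suc n) * rise \<alpha> (Suc n)))"
proof -
  have a: "rise \<alpha> (Suc n) \<ge> 1" using alpha_pos by (intro rise_ge_1) simp
  have "uniform_rate / real (vcount h) \<le> 2 * real N / p / real (Suc n) * 1" using tame_rate by simp
  also have "\<dots> \<le> 2 * real N / p / real (Suc n) * rise \<alpha> (Suc n)"
    using a p_pos by (intro mult_left_mono) auto
  finally have "2 * (\<alpha> * real (wt j h) / real (Suc n)) + uniform_rate / real (vcount h)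
     \<le> (2 * real L + 2 * real N / p) * (rise \<alpha> (Suc n) / real (Suc n))"
  proof -
    assume u: "uniform_rate / real (vcount h) \<le> 2 * real N / p / real (Suc n) * rise \<alpha> (Suc n)"
    have "(2 * real L + 2 * real N / p) * (rise \<alpha> (Suc n) / real (Suc n))
        = 2 * (real L * rise \<alpha> (Suc n) / real (Suc n)) + 2 * real N / p / real (Suc n) * rise \<alpha> (Suc n)"
      by (simp add: distrib_right add_divide_distrib)
    then show ?thesis using tame_prob(2) u by linarith
  qed
  then have "(2 * (\<alpha> * real (wt j h) / real (Suc n)) + uniform_rate / real (vcount h)) / (rise \<alpha> (Suc n))\<^sup>2
     \<le> (2 * real L + 2 * real N / p) * (rise \<alpha> (Suc n) / real (Suc n)) / (rise \<alpha> (Suc n))\<^sup>2"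
    by (intro divide_right_mono) auto
  also have "\<dots> = (2 * real L + 2 * real N / p) * (1 / (real (Suc n) * rise \<alpha> (Suc n)))"
    using a by (simp add: power2_eq_square del: of_nat_Suc)
  finally show ?thesis .
qed

lemma E_step_member_tame:
  "E_step (graph_h h) (\<lambda>S. of_bool (j \<in> S))
    = \<alpha> * real (wt j h) / real (Suc n) + uniform_rate / real (vcount h)"
  using E_step_member[OF reachable_model_graph[OF h]] tame unfolding tame_def by blast

lemma tame_mean:
  assumes "\<bar>x\<bar> \<le> real N * (uniform_rate / real (vcount h))"
  shows "\<bar>x / rise \<alpha> (Suc n)\<bar> \<le> real N * (2 * real N / p) * (1 / (real (Suc n) * rise \<alpha> (Suc n)))"
proof -
  have a: "rise \<alpha> (Suc n) \<ge> 1" using alpha_pos by (intro rise_ge_1) simp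
  have "real N * (uniform_rate / real (vcount h)) \<le> real N * (2 * real N / p / real (Suc n))"
    using tame_rate by (intro mult_left_mono) auto
  with assms have "\<bar>x\<bar> / rise \<alpha> (Suc n) \<le> real N * (2 * real N / p / real (Suc n)) / rise \<alpha> (Suc n)"
    using a by (intro divide_right_mono) auto
  then show ?thesis using a by (simp add: abs_divide)
qed

lemma unif_le_N_unif: "uniform_rate / real (vcount h) \<le> real N * (uniform_rate / real (vcount h))"
proof -
  have "0 \<le> uniform_rate / real (vcount h)" using uniform_rate_bounds by simp
  then have "1 * (uniform_rate / real (vcount h)) \<le> real N * (uniform_rate / real (vcount h))"
    using N_ge by (intro mult_right_mono) auto
  then show ?thesis by simp
qed

end

lemma summable_bound: "summable (\<lambda>n. c * (1 / (real (Suc n) * rise \<alpha> (Suc n))))"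
  by (rule summable_mult[OF summable_inverse_mult_rise[OF alpha_pos]])

lemma bound_nonneg: "c \<ge> 0 \<Longrightarrow> 0 \<le> c * (1 / (real (Suc n) * rise \<alpha> (Suc n)))"
  using rise_pos[of \<alpha> "Suc n"] alpha_pos by (intro mult_nonneg_nonneg) auto

text \<open>Dividing by \<open>rise \<alpha> n\<close> removes the drift alpha W / (n + 1) exactly,
  so only the uniform choices contribute to the conditional mean of an increment.\<close>

lemma AE_wt_convergent:
  "AE \<omega> in M. \<forall>j\<ge>1 - int N. convergent (\<lambda>n. real (wt j (hist n \<omega>)) / rise \<alpha> n)"
proof -
  define \<xi> where "\<xi> j h S = real (wt j (h @ [S])) / rise \<alpha> (Suc (length h)) - real (wt j h) / rise \<alpha> (length h)"
    for j h S
  have xi: "\<xi> j h S = (of_bool (j \<in> S) - \<alpha> * real (wt j h) / real (Suc (length h))) / rise \<alpha> (Suc (length h))"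
    for j h S
  proof -
    have a: "rise \<alpha> (length h) > 0" using alpha_pos by (intro rise_pos) simp
    have b: "1 + \<alpha> / real (Suc (length h)) > 0" using alpha_pos by (intro add_pos_pos divide_pos_pos) auto
    have "real (wt j h) / rise \<alpha> (length h)
        = real (wt j h) * (1 + \<alpha> / real (Suc (length h))) / rise \<alpha> (Suc (length h))"
      using a b by (simp add: rise_Suc del: of_nat_Suc)
    then show ?thesis
      unfolding \<xi>_def by (simp add: diff_divide_distrib[symmetric] wt_snoc algebra_simps del: graph_of_snoc)
  qed
  have "AE \<omega> in M. \<forall>j m L. (\<forall>n\<ge>m. tame j L (hist n \<omega>)) \<longrightarrow> summable (\<lambda>k. \<xi> j (hist k \<omega>) (I (Suc k) \<omega>))"
    unfolding AE_all_countable
  proof (intro allI)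
    fix j m L
    show "AE \<omega> in M. (\<forall>n\<ge>m. tame j L (hist n \<omega>)) \<longrightarrow> summable (\<lambda>k. \<xi> j (hist k \<omega>) (I (Suc k) \<omega>))"
    proof (rule increments_summable)
      fix n h assume h: "h \<in> reachable n" and tame: "tame j L h"
      note G = reachable_model_graph[OF h]
      have len: "length h = n" using h by (rule reachable_length)
      let ?x = "\<alpha> * real (wt j h) / real (Suc n)" and ?u = "uniform_rate / real (vcount h)"
      have mean: "E_step (graph_h h) (\<xi> j h) = ?u / rise \<alpha> (Suc n)"
        unfolding xi len
        by (simp only: E_step_divide[OF G] E_step_diff[OF G] E_step_const[OF G] E_step_member_tame[OF h tame]) simp
      have "\<bar>?u\<bar> \<le> real N * ?u"
        using unif_le_N_unif[OF h tame] uniform_rate_bounds by simp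
      from tame_mean[OF h tame this] show "\<bar>E_step (graph_h h) (\<xi> j h)\<bar>
          \<le> real N * (2 * real N / p) * (1 / (real (Suc n) * rise \<alpha> (Suc n)))"
        unfolding mean .
      have x: "0 \<le> ?x" "?x \<le> 1" using tame_prob(1)[OF h tame] alpha_pos by auto
      have "E_step (graph_h h) (\<lambda>S. (\<xi> j h S)\<^sup>2)
          \<le> E_step (graph_h h) (\<lambda>S. (of_bool (j \<in> S) + ?x) / (rise \<alpha> (Suc n))\<^sup>2)"
      proof (rule E_step_mono[OF G])
        fix S
        \<comment> \<open>Valid for an indicator and a number between 0 and 1; the right side is
          linear in the indicator, so its expectation is known.\<close>
        have "(of_bool (j \<in> S) - ?x)\<^sup>2 \<le> of_bool (j \<in> S) + ?x"
        proof -
          have "?x * ?x \<le> 1 * ?x" using x by (intro mult_right_mono)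
          then show ?thesis using x by (cases "j \<in> S") (simp_all add: power2_eq_square algebra_simps)
        qed
        then show "(\<xi> j h S)\<^sup>2 \<le> (of_bool (j \<in> S) + ?x) / (rise \<alpha> (Suc n))\<^sup>2"
          unfolding xi len power_divide by (intro divide_right_mono) auto
      qed
      also have "\<dots> = (2 * ?x + ?u) / (rise \<alpha> (Suc n))\<^sup>2"
        by (simp only: E_step_divide[OF G] E_step_add[OF G] E_step_const[OF G] E_step_member_tame[OF h tame]) simp
      also have "\<dots> \<le> (2 * real L + 2 * real N / p) * (1 / (real (Suc n) * rise \<alpha> (Suc n)))"
        by (rule tame_second_moment[OF h tame])
      finally show "E_step (graph_h h) (\<lambda>S. (\<xi> j h S)\<^sup>2)
          \<le> (2 * real L + 2 * real N / p) * (1 / (real (Suc n) * rise \<alpha> (Suc n)))" .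
    qed (rule summable_bound, rule summable_bound, rule bound_nonneg, use p_pos in auto)
  qed
  then show ?thesis
    using AE_eventually_tame
  proof eventually_elim
    case (elim \<omega>)
    show ?case
    proof (intro allI impI)
      fix j assume "j \<ge> 1 - int N"
      with elim have "summable (\<lambda>k. \<xi> j (hist k \<omega>) (I (Suc k) \<omega>))" by blast
      moreover have "(\<Sum>k<n. \<xi> j (hist k \<omega>) (I (Suc k) \<omega>))
          = real (wt j (hist n \<omega>)) / rise \<alpha> n - real (wt j [])" for n
        unfolding \<xi>_def length_hist hist_Suc[symmetric] by (subst sum_lessThan_telescope) simp
      ultimately have "convergent (\<lambda>n. real (wt j (hist n \<omega>)) / rise \<alpha> n - real (wt j []))"
        by (simp add: summable_iff_convergent)
      then show "convergent (\<lambda>n. real (wt j (hist n \<omega>)) / rise \<alpha> n)"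
        by (simp only: convergent_diff_const_right_iff)
    qed
  qed
qed

text \<open>The constant alpha_2 / alpha is the one for which the preferential drifts of the degree
  and of the multiple of the weight cancel. Since the increments of the difference, not the
  difference itself, are divided by \<open>rise\<close>, their series converges and Kronecker's
  lemma gives the limit 0.\<close>

lemma AE_degree_asymp:
  "AE \<omega> in M. \<forall>j\<ge>1 - int N.
     (\<lambda>n. (real (dg j (hist n \<omega>)) - alpha2 N p r / \<alpha> * real (wt j (hist n \<omega>))) / rise \<alpha> n) \<longlonglongrightarrow> 0"
proof -
  define c where "c = alpha2 N p r / \<alpha>"
  have c: "0 \<le> c" "c \<le> 1" unfolding c_def using alpha2_nonneg alpha2_le alpha_pos by auto
  define R where "R j h = real (dg j h) - c * real (wt j h)" for j h
  define \<xi> where "\<xi> j h S = (R j (h @ [S]) - R j h) / rise \<alpha> (Suc (length h))" for j h S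
  have "AE \<omega> in M. \<forall>j m L. (\<forall>n\<ge>m. tame j L (hist n \<omega>)) \<longrightarrow> summable (\<lambda>k. \<xi> j (hist k \<omega>) (I (Suc k) \<omega>))"
    unfolding AE_all_countable
  proof (intro allI)
    fix j m L
    show "AE \<omega> in M. (\<forall>n\<ge>m. tame j L (hist n \<omega>)) \<longrightarrow> summable (\<lambda>k. \<xi> j (hist k \<omega>) (I (Suc k) \<omega>))"
    proof (rule increments_summable)
      fix n h assume h: "h \<in> reachable n" and tame: "tame j L h"
      note G = reachable_model_graph[OF h]
      have len: "length h = n" using h by (rule reachable_length)
      have j: "j \<in> verts (graph_h h)" using tame by (simp add: tame_def)
      let ?x = "\<alpha> * real (wt j h) / real (Suc n)" and ?u = "uniform_rate / real (vcount h)"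
      let ?D = "\<lambda>S. real (degree_in (interact S (graph_h h)) j) - real (dg j h)"
      have u0: "0 \<le> ?u" using uniform_rate_bounds by simp
      have incr: "R j (h @ [S]) - R j h = ?D S - c * of_bool (j \<in> S)" for S
        unfolding R_def wt_snoc by (simp add: algebra_simps)
      define e where "e = E_step (graph_h h) ?D - c * (?x + ?u)"
      have mean: "E_step (graph_h h) (\<xi> j h) = e / rise \<alpha> (Suc n)"
        unfolding \<xi>_def len incr e_def
        by (simp only: E_step_divide[OF G] E_step_diff[OF G, of ?D] E_step_cmult[OF G] E_step_member_tame[OF h tame])
      have cx: "c * ?x = alpha2 N p r * real (wt j h) / real (Suc n)"
        unfolding c_def using alpha_pos by simp
      have "c * ?u \<le> 1 * ?u" using c u0 by (intro mult_right_mono) auto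
      moreover have "c * ?u \<ge> 0" by (rule mult_nonneg_nonneg[OF c(1) u0])
      moreover have "c * (?x + ?u) = alpha2 N p r * real (wt j h) / real (Suc n) + c * ?u"
        by (simp only: distrib_left cx)
      moreover have "real N * uniform_rate / real (vcount h) = real N * ?u" by simp
      \<comment> \<open>After the cancellation there remains a term between 0 and
        \<open>N * ?u\<close> from the degree, minus \<open>c * ?u\<close>, which is at most
        \<open>?u\<close>.\<close>
      ultimately have "\<bar>e\<bar> \<le> real N * ?u"
        using E_step_degree[OF G j] unif_le_N_unif[OF h tame] unfolding e_def abs_le_iff by linarith
      from tame_mean[OF h tame this] show "\<bar>E_step (graph_h h) (\<xi> j h)\<bar>
          \<le> real N * (2 * real N / p) * (1 / (real (Suc n) * rise \<alpha> (Suc n)))"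
        unfolding mean .
      have "E_step (graph_h h) (\<lambda>S. (\<xi> j h S)\<^sup>2)
          \<le> E_step (graph_h h) (\<lambda>S. (real N ^ 2 * of_bool (j \<in> S)) / (rise \<alpha> (Suc n))\<^sup>2)"
      proof (rule E_step_mono[OF G])
        fix S assume S: "admissible N (graph_h h) S"
        have "real (degree_in (interact S (graph_h h)) j) \<le> real (dg j h + (N - 1) * of_bool (j \<in> S))"
          using degree_increment_bounds(2)[OF G S] by (rule of_nat_mono)
        moreover have "0 \<le> ?D S" using degree_increment_bounds(1)[OF G S, of j] by simp
        \<comment> \<open>Both the degree and the weight change only if \<open>j\<close> takes part,
          the degree by at most N - 1 and \<open>c\<close> times the weight by at most 1.\<close>
        ultimately have "\<bar>?D S - c * of_bool (j \<in> S)\<bar> \<le> real N * of_bool (j \<in> S)"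
          using c N_ge by (cases "j \<in> S") (auto simp: of_nat_diff simp del: One_nat_def)
        then have "\<bar>?D S - c * of_bool (j \<in> S)\<bar>\<^sup>2 \<le> (real N * of_bool (j \<in> S))\<^sup>2"
          by (intro power_mono) auto
        then have "(R j (h @ [S]) - R j h)\<^sup>2 \<le> real N ^ 2 * of_bool (j \<in> S)"
          unfolding incr power2_abs by (cases "j \<in> S") auto
        then show "(\<xi> j h S)\<^sup>2 \<le> (real N ^ 2 * of_bool (j \<in> S)) / (rise \<alpha> (Suc n))\<^sup>2"
          unfolding \<xi>_def len power_divide by (intro divide_right_mono) auto
      qed
      also have "\<dots> = (real N ^ 2 * (?x + ?u)) / (rise \<alpha> (Suc n))\<^sup>2"
        by (simp only: E_step_divide[OF G] E_step_cmult[OF G] E_step_member_tame[OF h tame])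
      also have "\<dots> \<le> (real N ^ 2 * (2 * ?x + ?u)) / (rise \<alpha> (Suc n))\<^sup>2"
      proof (intro divide_right_mono mult_left_mono)
        have "0 \<le> ?x" using alpha_pos by simp
        then show "?x + ?u \<le> 2 * ?x + ?u" by linarith
      qed auto
      also have "\<dots> = real N ^ 2 * ((2 * ?x + ?u) / (rise \<alpha> (Suc n))\<^sup>2)" by simp
      also have "\<dots> \<le> real N ^ 2 * ((2 * real L + 2 * real N / p) * (1 / (real (Suc n) * rise \<alpha> (Suc n))))"
        by (intro mult_left_mono tame_second_moment[OF h tame]) simp
      finally show "E_step (graph_h h) (\<lambda>S. (\<xi> j h S)\<^sup>2)
          \<le> real N ^ 2 * (2 * real L + 2 * real N / p) * (1 / (real (Suc n) * rise \<alpha> (Suc n)))"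
        by (simp only: mult.assoc)
    qed (rule summable_bound, rule summable_bound, rule bound_nonneg, use p_pos in auto)
  qed
  then show ?thesis
    using AE_eventually_tame
  proof eventually_elim
    case (elim \<omega>)
    show ?case
    proof (intro allI impI)
      fix j assume "j \<ge> 1 - int N"
      with elim have "summable (\<lambda>k. \<xi> j (hist k \<omega>) (I (Suc k) \<omega>))" by blast
      then have "summable (\<lambda>k. (R j (hist (Suc k) \<omega>) - R j (hist k \<omega>)) / rise \<alpha> (Suc k))"
        unfolding \<xi>_def length_hist hist_Suc[symmetric] .
      then have "(\<lambda>n. (\<Sum>k<n. R j (hist (Suc k) \<omega>) - R j (hist k \<omega>)) / rise \<alpha> (Suc n)) \<longlonglongrightarrow> 0"
      proof (rule kronecker)
        show "rise \<alpha> (Suc k) > 0" for k using alpha_pos by (intro rise_pos) simp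
        show "incseq (\<lambda>k. rise \<alpha> (Suc k))"
          using incseq_rise[of \<alpha>] alpha_pos by (simp add: incseq_def)
        show "filterlim (\<lambda>k. rise \<alpha> (Suc k)) at_top sequentially"
          by (rule filterlim_compose[OF filterlim_rise[OF alpha_pos] filterlim_Suc])
      qed
      then have "(\<lambda>n. (R j (hist n \<omega>) - R j []) / rise \<alpha> (Suc n)) \<longlonglongrightarrow> 0"
        by (simp only: sum_lessThan_telescope[of "\<lambda>k. R j (hist k \<omega>)"] hist_0)
      moreover have "(\<lambda>n. R j [] / rise \<alpha> (Suc n)) \<longlonglongrightarrow> 0"
        by (rule tendsto_divide_0[OF tendsto_const filterlim_at_top_imp_at_infinity[OF
             filterlim_compose[OF filterlim_rise[OF alpha_pos] filterlim_Suc]]])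
      ultimately have "(\<lambda>n. (R j (hist n \<omega>) - R j []) / rise \<alpha> (Suc n) + R j [] / rise \<alpha> (Suc n)) \<longlonglongrightarrow> 0 + 0"
        by (rule tendsto_add)
      then have "(\<lambda>n. R j (hist n \<omega>) / rise \<alpha> (Suc n)) \<longlonglongrightarrow> 0"
        by (simp add: add_divide_distrib[symmetric])
      \<comment> \<open>This factor is \<open>rise \<alpha> (Suc n) / rise \<alpha> n\<close> and
        undoes the index shift of the normalisation.\<close>
      moreover have "(\<lambda>n. 1 + \<alpha> / real (Suc n)) \<longlonglongrightarrow> 1" by real_asymp
      ultimately have "(\<lambda>n. R j (hist n \<omega>) / rise \<alpha> (Suc n) * (1 + \<alpha> / real (Suc n))) \<longlonglongrightarrow> 0 * 1"
        by (rule tendsto_mult)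
      moreover have "R j (hist n \<omega>) / rise \<alpha> (Suc n) * (1 + \<alpha> / real (Suc n)) = R j (hist n \<omega>) / rise \<alpha> n" for n
      proof -
        have "1 + \<alpha> / real (Suc n) > 0" using alpha_pos by (intro add_pos_pos divide_pos_pos) auto
        then show ?thesis by (simp add: rise_Suc del: of_nat_Suc)
      qed
      ultimately show "(\<lambda>n. (real (dg j (hist n \<omega>)) - alpha2 N p r / \<alpha> * real (wt j (hist n \<omega>))) / rise \<alpha> n) \<longlonglongrightarrow> 0"
        by (simp add: R_def c_def)
    qed
  qed
qed

text \<open>Positivity of the limit: the function \<open>w \<mapsto> rise (- 1 / 2) (w - 1)\<close> of the weight, which is of
  order \<open>w powr (- 1 / 2)\<close>, becomes a supermartingale after division by \<open>rise (- \<alpha> / 2) n\<close>.\<close>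

lemma AE_wt_lower_bound:
  "AE \<omega> in M. \<exists>e>0. \<forall>n\<ge>1. real (wt 0 (hist n \<omega>)) \<ge> e * real n powr \<alpha>"
proof -
  \<comment> \<open>With the shift by 1 the ratio \<open>f (w + 1) / f w\<close> is 1 - 1 / (2 w)
    for w >= 1. The relative decrease times the preferential hitting probability alpha w / (n + 1)
    is then alpha / (2 (n + 1)), independent of w.\<close>
  define f where "f w = rise (- 1 / 2) (w - 1)" for w :: nat
  define Z where "Z h = f (wt 0 h) / rise (- \<alpha> / 2) (length h)" for h
  have half: "- \<alpha> / 2 > - 1" using alpha_le_1 by simp
  have f_pos: "f w > 0" for w unfolding f_def by (rule rise_pos) simp
  have r_pos: "rise (- \<alpha> / 2) n > 0" for n by (rule rise_pos[OF half])
  \<comment> \<open>Label 0 belongs to an initial vertex, which is present at all times.\<close>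
  have zero: "0 \<in> verts (graph_h h)" if "h \<in> reachable n" for h n
    using card_verts_ge[OF N_ge reachable_model_graph[OF that]] N_ge
    by (subst verts_eq[OF N_ge reachable_model_graph[OF that]]) auto
  have "AE \<omega> in M. \<exists>C. \<forall>n\<ge>0. Z (hist n \<omega>) \<le> C"
  proof (rule supermartingale_bounded)
    fix n h assume h: "h \<in> reachable n"
    note G = reachable_model_graph[OF h]
    have len: "length h = n" using h by (rule reachable_length)
    show "0 \<le> Z h" unfolding Z_def using f_pos r_pos by (simp add: less_imp_le)
    have w: "wt 0 h \<ge> 1" by (rule weight_vertex_pos[OF N_ge G zero[OF h]])
    then have "f (wt 0 h + 1) = f (wt 0 h) * (1 + (- 1 / 2) / real (wt 0 h))"
      unfolding f_def by (metis Suc_diff_1 Suc_eq_plus1 add_diff_cancel_right' less_le_trans rise_Suc zero_less_one)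
    then have diff: "f (wt 0 h + 1) - f (wt 0 h) = - (f (wt 0 h) / (2 * real (wt 0 h)))"
      by (simp add: algebra_simps)
    have "E_step (graph_h h) (\<lambda>S. f (wt 0 (h @ [S])))
        = f (wt 0 h) - (\<alpha> * real (wt 0 h) / real (Suc n) + uniform_rate / real (vcount h)) * (f (wt 0 h) / (2 * real (wt 0 h)))"
      unfolding E_step_wt[OF h zero[OF h], of f] diff by simp
    \<comment> \<open>\<open>f\<close> is decreasing, so leaving out the uniform hits can only
      enlarge the expectation.\<close>
    also have "\<dots> \<le> f (wt 0 h) - (\<alpha> * real (wt 0 h) / real (Suc n)) * (f (wt 0 h) / (2 * real (wt 0 h)))"
      using uniform_rate_bounds f_pos by (intro diff_left_mono mult_right_mono) (auto simp: less_imp_le)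
    also have "\<dots> = (1 + (- \<alpha> / 2) / real (Suc n)) * f (wt 0 h)"
      using w by (simp add: algebra_simps del: of_nat_Suc)
    finally have "E_step (graph_h h) (\<lambda>S. f (wt 0 (h @ [S]))) / rise (- \<alpha> / 2) (Suc n)
        \<le> (1 + (- \<alpha> / 2) / real (Suc n)) * f (wt 0 h) / rise (- \<alpha> / 2) (Suc n)"
      using r_pos by (intro divide_right_mono) (auto simp: less_imp_le)
    also have "\<dots> = f (wt 0 h) / rise (- \<alpha> / 2) n"
    proof -
      have "1 + (- \<alpha> / 2) / real (Suc n) \<noteq> 0"
        using r_pos[of "Suc n"] unfolding rise_Suc by (metis less_irrefl mult_zero_right)
      then show ?thesis unfolding rise_Suc by (metis mult.commute nonzero_mult_divide_mult_cancel_left)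
    qed
    finally show "E_step (graph_h h) (\<lambda>S. Z (h @ [S])) \<le> Z h"
      unfolding Z_def length_append len using E_step_divide[OF G] by simp
  qed
  then show ?thesis
    using AE_reachable
  proof eventually_elim
    case (elim \<omega>)
    then obtain C where C: "\<And>n. Z (hist n \<omega>) \<le> C" by blast
    have "Z (hist 0 \<omega>) > 0" unfolding Z_def using f_pos r_pos by simp
    then have C_pos: "C > 0" using C[of 0] by linarith
    obtain c where c: "c > 0" "\<And>n. n \<ge> 1 \<Longrightarrow> rise (- \<alpha> / 2) n \<le> c * real n powr (- \<alpha> / 2)"
      using rise_le_powr[OF half] by blast
    \<comment> \<open>Combines 1 / (4 W) <= f(W)^2 with the bound C c n^(-alpha/2) on f(W).\<close>
    define K where "K = (C * c)\<^sup>2"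
    have K: "K > 0" unfolding K_def using C_pos c by simp
    have "1 / (4 * K) * real n powr \<alpha> \<le> real (wt 0 (hist n \<omega>))" if n: "n \<ge> 1" for n
    proof -
      let ?w = "wt 0 (hist n \<omega>)"
      have h: "hist n \<omega> \<in> reachable n" using elim by blast
      have w: "?w \<ge> 1" by (rule weight_vertex_pos[OF N_ge reachable_model_graph[OF h] zero[OF h]])
      have "f ?w \<le> C * rise (- \<alpha> / 2) n"
        using C[of n] r_pos[of n] unfolding Z_def by (simp add: pos_divide_le_eq)
      also have "\<dots> \<le> C * (c * real n powr (- \<alpha> / 2))"
        using c(2)[OF n] C_pos by (intro mult_left_mono) auto
      finally have "(f ?w)\<^sup>2 \<le> (C * c * real n powr (- \<alpha> / 2))\<^sup>2"
        using f_pos[of ?w] by (intro power_mono) (auto simp: mult.assoc)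
      also have "\<dots> = K * real n powr (- \<alpha>)"
        unfolding K_def power_mult_distrib using n by (simp add: powr_power)
      finally have upper: "(f ?w)\<^sup>2 \<le> K * real n powr (- \<alpha>)" .
      have "1 / (4 * real ?w) \<le> (f ?w)\<^sup>2"
      \<comment> \<open>Weight 1 gives the empty product, which is outside the range of
        \<open>rise_minus_half\<close>.\<close>
      proof (cases "?w = 1")
        case True
        then show ?thesis by (simp add: f_def)
      next
        case False
        then have "1 \<le> ?w - 1" using w by simp
        then have "1 / (4 * real ?w) \<le> 1 / (4 * real (?w - 1))"
          by (intro divide_left_mono) auto
        also have "\<dots> \<le> (f ?w)\<^sup>2"
          unfolding f_def by (rule rise_minus_half) fact
        finally show ?thesis .
      qed
      then have "1 / (4 * real ?w) \<le> K * real n powr (- \<alpha>)" using upper by linarith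
      then show ?thesis using w K n by (simp add: powr_minus field_simps)
    qed
    moreover have "1 / (4 * K) > 0" using K by simp
    ultimately show ?case by blast
  qed
qed

end
end

section \<open>The maximal degree\<close>

lemma cSUP_mult_left:
  fixes f :: "'b \<Rightarrow> real"
  assumes "A \<noteq> {}" "bdd_above (f ` A)" "c \<ge> 0"
  shows "(SUP x\<in>A. c * f x) = c * (SUP x\<in>A. f x)" and "bdd_above ((\<lambda>x. c * f x) ` A)"
proof -
  have le: "c * f x \<le> c * (SUP x\<in>A. f x)" if "x \<in> A" for x
    using assms that by (intro mult_left_mono cSUP_upper)
  then show bdd: "bdd_above ((\<lambda>x. c * f x) ` A)" by (rule bdd_aboveI2)
  show "(SUP x\<in>A. c * f x) = c * (SUP x\<in>A. f x)"
  proof (cases "c = 0")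
    case True
    then show ?thesis using assms(1) by simp
  next
    case False
    show ?thesis
    proof (rule antisym)
      show "(SUP x\<in>A. c * f x) \<le> c * (SUP x\<in>A. f x)"
        using assms(1) le by (rule cSUP_least)
      have "f x \<le> (SUP x\<in>A. c * f x) / c" if "x \<in> A" for x
        using cSUP_upper[OF that bdd] False assms(3) by (simp add: field_simps)
      then have "(SUP x\<in>A. f x) \<le> (SUP x\<in>A. c * f x) / c"
        using assms(1) by (intro cSUP_least)
      then show "c * (SUP x\<in>A. f x) \<le> (SUP x\<in>A. c * f x)"
        using False assms(3) by (simp add: field_simps)
    qed
  qed
qed

context nondegenerate_model
begin

lemma vertex_weight_hist: "vertex_weight N (\<lambda>k. I k \<omega>) n j = wt j (hist n \<omega>)"
  by (simp add: vertex_weight_def graph_after_hist)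

lemma vertex_degree_hist: "vertex_degree N (\<lambda>k. I k \<omega>) n j = dg j (hist n \<omega>)"
  by (simp add: vertex_degree_def degree_in_def graph_after_hist)

lemma measurable_mu_sup: "(\<lambda>\<omega>. mu_sup N a (\<lambda>k. I k \<omega>)) \<in> borel_measurable M"
  unfolding mu_sup_def gamma_limit_def vertex_weight_hist
proof (rule borel_measurable_SUP)
  fix j
  have "(\<lambda>\<omega>. real n powr (- a) * real (wt j (hist n \<omega>))) \<in> borel_measurable M" for n
    by (rule measurable_of_hist(2)[of "\<lambda>h. real n powr (- a) * real (wt j h)"])
  then show "(\<lambda>\<omega>. ereal (Gamma (1 + a) * lim (\<lambda>n. real n powr (- a) * real (wt j (hist n \<omega>))))) \<in> borel_measurable M"
    by measurable
qed simp

text \<open>On almost every path the scaled degrees converge label by label to alpha_2 / alpha times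
  \<open>l j\<close>, the limit of the scaled weight, with a uniform bound for late labels, so
  \<open>Max_tendsto_SUP\<close> applies. As \<open>gamma_limit\<close> is Gamma(1 + alpha) times
  \<open>l j\<close>, the Gamma factors of the claim cancel.\<close>

theorem max_degree_asymp:
  assumes alpha_pos: "\<alpha> > 0"
  defines "\<mu> \<equiv> (\<lambda>\<omega>. mu_sup N \<alpha> (\<lambda>k. I k \<omega>))"
  shows "AE \<omega> in M. 0 < \<mu> \<omega> \<and> \<mu> \<omega> < \<infinity> \<and>
    (\<lambda>n. real n powr (- \<alpha>) * real (max_degree N (\<lambda>k. I k \<omega>) n))
      \<longlonglongrightarrow> 1 / Gamma (1 + \<alpha>) * (alpha2 N p r / \<alpha>) * real_of_ereal (\<mu> \<omega>)"
proof -
  obtain m :: nat where "real m \<ge> 2 / \<alpha>" using real_arch_simple by blast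
  then have m: "real m * \<alpha> \<ge> 2" using alpha_pos by (simp add: field_simps)
  have gt: "\<alpha> > -1" using alpha_pos by simp
  obtain c where c: "c > 0" "\<And>n. n \<ge> 1 \<Longrightarrow> rise \<alpha> n \<le> c * real n powr \<alpha>"
    using rise_le_powr[OF gt] by blast
  have Gamma_pos: "Gamma (1 + \<alpha>) > 0" using alpha_pos by (intro Gamma_real_pos) simp
  show ?thesis
    using AE_reachable AE_wt_tail[OF alpha_pos m] AE_wt_convergent[OF alpha_pos]
      AE_degree_asymp[OF alpha_pos] AE_wt_lower_bound[OF alpha_pos]
  proof eventually_elim
    case (elim \<omega>)
    define w where "w n j = real n powr (- \<alpha>) * real (wt j (hist n \<omega>))" for n j
    define d where "d n j = real n powr (- \<alpha>) * real (dg j (hist n \<omega>))" for n j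
    define l where "l j = lim (\<lambda>n. w n j)" for j
    define \<beta> where "\<beta> = alpha2 N p r / \<alpha>"
    have \<beta>: "\<beta> \<ge> 0" unfolding \<beta>_def using alpha2_nonneg alpha_pos by simp
    have rise_ne: "rise \<alpha> n \<noteq> 0" for n using rise_pos[OF gt, of n] by simp
    have w_lim: "(\<lambda>n. w n j) \<longlonglongrightarrow> l j" if j: "j \<ge> 1 - int N" for j
    proof -
      from elim(3) j obtain x where x: "(\<lambda>n. real (wt j (hist n \<omega>)) / rise \<alpha> n) \<longlonglongrightarrow> x"
        unfolding convergent_def by blast
      have "(\<lambda>n. (real n powr (- \<alpha>) * rise \<alpha> n) * (real (wt j (hist n \<omega>)) / rise \<alpha> n)) \<longlonglongrightarrow> 1 / Gamma (1 + \<alpha>) * x"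
        by (rule tendsto_mult[OF rise_asymp[OF gt] x])
      then have "convergent (\<lambda>n. w n j)"
        unfolding w_def convergent_def using rise_ne by auto
      then show ?thesis unfolding l_def by (simp add: convergent_LIMSEQ_iff)
    qed
    have d_lim: "(\<lambda>n. d n j) \<longlonglongrightarrow> \<beta> * l j" if j: "j \<ge> 1 - int N" for j
    proof -
      have "(\<lambda>n. (real n powr (- \<alpha>) * rise \<alpha> n) *
          ((real (dg j (hist n \<omega>)) - \<beta> * real (wt j (hist n \<omega>))) / rise \<alpha> n)) \<longlonglongrightarrow> 1 / Gamma (1 + \<alpha>) * 0"
        unfolding \<beta>_def using elim(4) j by (intro tendsto_mult[OF rise_asymp[OF gt]]) auto
      then have "(\<lambda>n. real n powr (- \<alpha>) * (real (dg j (hist n \<omega>)) - \<beta> * real (wt j (hist n \<omega>)))) \<longlonglongrightarrow> 0"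
        using rise_ne by simp
      then have "(\<lambda>n. d n j - \<beta> * w n j) \<longlonglongrightarrow> 0"
        unfolding w_def d_def
        by (simp add: right_diff_distrib mult.left_commute)
      from tendsto_add[OF this tendsto_mult_left[OF w_lim[OF j], of \<beta>]] show ?thesis by simp
    qed
    have w_tail: "\<exists>J. \<forall>\<^sub>F n in sequentially. \<forall>j\<ge>J. w n j \<le> \<epsilon>" if "\<epsilon> > 0" for \<epsilon>
    proof -
      \<comment> \<open>The constant \<open>c\<close> translates the normalisation by
        \<open>rise \<alpha> n\<close> into one by n^alpha.\<close>
      from elim(2) obtain J where J: "\<And>n j. n \<ge> J \<Longrightarrow> j \<ge> int J \<Longrightarrow> real (wt j (hist n \<omega>)) \<le> \<epsilon> / c * rise \<alpha> n"
        using \<open>\<epsilon> > 0\<close> c(1) by (meson divide_pos_pos)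
      have "w n j \<le> \<epsilon>" if n: "n \<ge> max 1 J" and j: "j \<ge> int J" for n j
      proof -
        have "real (wt j (hist n \<omega>)) \<le> \<epsilon> / c * rise \<alpha> n" using J n j by auto
        also have "\<dots> \<le> \<epsilon> / c * (c * real n powr \<alpha>)"
          using c n \<open>\<epsilon> > 0\<close> by (intro mult_left_mono) auto
        also have "\<dots> = \<epsilon> * real n powr \<alpha>" using c by simp
        finally show ?thesis using n unfolding w_def by (simp add: powr_minus field_simps)
      qed
      then have "\<forall>\<^sub>F n in sequentially. \<forall>j\<ge>int J. w n j \<le> \<epsilon>"
        using eventually_sequentially by blast
      then show ?thesis by blast
    qed
    have d_tail: "\<exists>J. \<forall>\<^sub>F n in sequentially. \<forall>j\<ge>J. d n j \<le> \<epsilon>" if "\<epsilon> > 0" for \<epsilon>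
    proof -
      \<comment> \<open>An interaction brings a vertex at most N - 1 neighbours, so late degrees
        inherit the uniform bound on late weights.\<close>
      have dw: "d n j \<le> real N * w n j" for n j
      proof -
        have "dg j (hist n \<omega>) \<le> (N - 1) * wt j (hist n \<omega>)"
          by (rule degree_le_weight[OF N_ge reachable_model_graph]) (use elim(1) in blast)
        also have "\<dots> \<le> N * wt j (hist n \<omega>)" by (intro mult_right_mono) auto
        finally have "real (dg j (hist n \<omega>)) \<le> real N * real (wt j (hist n \<omega>))"
          by (metis of_nat_le_iff of_nat_mult)
        then have "real n powr (- \<alpha>) * real (dg j (hist n \<omega>))
            \<le> real n powr (- \<alpha>) * (real N * real (wt j (hist n \<omega>)))"
          by (intro mult_left_mono) auto
        then show ?thesis unfolding d_def w_def by (simp add: algebra_simps)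
      qed
      have "\<epsilon> / real N > 0" using \<open>\<epsilon> > 0\<close> N_ge by simp
      from w_tail[OF this] obtain J where "\<forall>\<^sub>F n in sequentially. \<forall>j\<ge>J. w n j \<le> \<epsilon> / real N" by blast
      then have "\<forall>\<^sub>F n in sequentially. \<forall>j\<ge>J. d n j \<le> \<epsilon>"
      proof eventually_elim
        case (elim n)
        then have "real N * w n j \<le> \<epsilon>" if "j \<ge> J" for j
          using that N_ge by (simp add: field_simps)
        then show ?case using dw by (meson order_trans)
      qed
      then show ?thesis by blast
    qed
    have bdd: "bdd_above (l ` {1 - int N..})"
      by (rule Max_tendsto_SUP(1)[OF w_lim _ w_tail]) (auto simp: w_def)
    define s where "s = (SUP j\<in>{1 - int N..}. l j)"
    have ne: "{1 - int N..} \<noteq> {}" by simp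
    have lim: "(\<lambda>n. Max (d n ` {1 - int N..int n})) \<longlonglongrightarrow> \<beta> * s"
      unfolding s_def cSUP_mult_left(1)[OF ne bdd \<beta>, symmetric]
      by (rule Max_tendsto_SUP(2)[OF d_lim _ d_tail]) (auto simp: d_def)
    have "s > 0"
    \<comment> \<open>One initial vertex with a positive limit makes the supremum positive.\<close>
    proof -
      from elim(5) obtain e where e: "e > 0" "\<And>n. n \<ge> 1 \<Longrightarrow> e * real n powr \<alpha> \<le> real (wt 0 (hist n \<omega>))" by blast
      have "e \<le> w n 0" if "n \<ge> 1" for n
        using e(2)[OF that] that unfolding w_def by (simp add: powr_minus field_simps)
      then have "e \<le> l 0" using N_ge by (intro LIMSEQ_le_const[OF w_lim]) auto
      also have "\<dots> \<le> s" unfolding s_def using N_ge by (intro cSUP_upper bdd) auto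
      finally show ?thesis using e(1) by simp
    qed
    have mu: "\<mu> \<omega> = ereal (Gamma (1 + \<alpha>) * s)"
    proof -
      let ?f = "\<lambda>j. Gamma (1 + \<alpha>) * l j"
      note sup = cSUP_mult_left[OF ne bdd less_imp_le[OF Gamma_pos]]
      \<comment> \<open>The extended supremum is finite: it is at most the real one and at least the
        value at label 0.\<close>
      have "(SUP j\<in>{1 - int N..}. ereal (?f j)) = ereal (SUP j\<in>{1 - int N..}. ?f j)"
      proof (rule ereal_SUP[symmetric])
        have "(SUP j\<in>{1 - int N..}. ereal (?f j)) \<le> ereal (SUP j\<in>{1 - int N..}. ?f j)"
          by (rule SUP_least) (simp only: ereal_less_eq(3) cSUP_upper[OF _ sup(2)])
        moreover have "ereal (?f 0) \<le> (SUP j\<in>{1 - int N..}. ereal (?f j))"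
          using N_ge by (intro SUP_upper) auto
        ultimately show "\<bar>SUP j\<in>{1 - int N..}. ereal (?f j)\<bar> \<noteq> \<infinity>" by auto
      qed
      then show ?thesis
        unfolding \<mu>_def mu_sup_def gamma_limit_def vertex_weight_hist w_def[symmetric] l_def[symmetric]
          sup(1) s_def .
    qed
    have "real n powr (- \<alpha>) * real (max_degree N (\<lambda>k. I k \<omega>) n) = Max (d n ` {1 - int N..int n})" for n
    proof -
      have "mono (\<lambda>k. real n powr (- \<alpha>) * real k)" by (auto intro!: monoI mult_left_mono)
      moreover have "{1 - int N..int n} \<noteq> {}" using N_ge by simp
      ultimately have "real n powr (- \<alpha>) * real (Max ((\<lambda>j. dg j (hist n \<omega>)) ` {1 - int N..int n}))
          = Max ((\<lambda>k. real n powr (- \<alpha>) * real k) ` (\<lambda>j. dg j (hist n \<omega>)) ` {1 - int N..int n})"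
        by (intro mono_Max_commute) auto
      then show ?thesis
        unfolding max_degree_def vertex_degree_hist d_def image_image .
    qed
    then have "(\<lambda>n. real n powr (- \<alpha>) * real (max_degree N (\<lambda>k. I k \<omega>) n)) \<longlonglongrightarrow> \<beta> * s"
      using lim by simp
    moreover have "\<beta> * s = 1 / Gamma (1 + \<alpha>) * (alpha2 N p r / \<alpha>) * real_of_ereal (\<mu> \<omega>)"
      unfolding mu \<beta>_def using Gamma_pos by simp
    ultimately show ?case using mu \<open>s > 0\<close> Gamma_pos by simp
  qed
qed

end

theorem theorem2p4:
  fixes M :: "'a measure" and N :: nat and p q r :: real and I :: "nat \<Rightarrow> 'a \<Rightarrow> int set"
  defines "\<alpha> \<equiv> alpha N p q r"
    and "\<mu> \<equiv> (\<lambda>\<omega>. mu_sup N (alpha N p q r) (\<lambda>k. I k \<omega>))"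
  assumes "N \<ge> 3" and "0 < p" "p \<le> 1" and "0 \<le> q" "q \<le> 1" and "0 \<le> r" "r \<le> 1"
    and "N_interactions_model M N p q r I"
    and "\<alpha> > 0"
  shows "\<mu> \<in> borel_measurable M
    \<and> (AE \<omega> in M. 0 < \<mu> \<omega> \<and> \<mu> \<omega> < \<infinity>)
    \<and> (AE \<omega> in M.
          (\<lambda>n. real n powr (- \<alpha>) * real (max_degree N (\<lambda>k. I k \<omega>) n))
            \<longlonglongrightarrow> 1 / Gamma (1 + \<alpha>) * (alpha2 N p r / \<alpha>) * real_of_ereal (\<mu> \<omega>))"
proof -
  interpret nondegenerate_model M N p q r I
    by (intro nondegenerate_model.intro interaction_params.intro assms)
  from \<open>\<alpha> > 0\<close> have "alpha N p q r > 0" by (simp add: \<alpha>_def)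
  from max_degree_asymp[OF this] measurable_mu_sup[of "alpha N p q r"] show ?thesis
    unfolding \<alpha>_def \<mu>_def by simp
qed

end
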